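(* Let $\alpha>-1$ and $-1<\beta\le 0$. For every $f\in BMO$ we have $$|\mathbb B_{\alpha,\beta}f(z)-\mathbb B_{\alpha,\beta}f(w)|\leq 2\,\|f\|_{BMO}\,\mathbf d_{\alpha,\beta}(z,w)\qquad\text{for all } z,w\in\mathbb D.$$
   Context: $\mathbb D$ is the open unit disk of $\mathbb C$ and $dA(z)=\frac1\pi\,dx\,dy$. For $\alpha>-1$, $-1<\beta\le0$, $$d\mu_{\alpha,\beta}(z)=\frac{|z|^{2\beta}(1-|z|^2)^{\alpha}}{\mathscr B(\alpha+1,\beta+1)}\,dA(z),\qquad \mathscr B(x,y)=\frac{\Gamma(x)\Gamma(y)}{\Gamma(x+y)},$$ is a probability measure on $\mathbb D$, and $$\mathcal K_{\alpha,\beta}(\xi)={}_2F_1(1,\alpha+\beta+2;\beta+1;\xi)=\sum_{n=0}^{\infty}\frac{(\alpha+\beta+2)_n}{(\beta+1)_n}\xi^n,\qquad \xi\in\mathbb D,$$ with $(x)_n=x(x+1)\cdots(x+n-1)$. (So $\mathcal K_{\alpha,\beta}(z\overline w)$ is the reproducing kernel of the space of holomorphic functions in $L^2(\mathbb D,\mu_{\alpha,\beta})$.) Berezin transform: $\displaystyle \mathbb B_{\alpha,\beta}f(z)=\int_{\mathbb D}f(w)\frac{|\mathcal K_{\alpha,\beta}(w\overline z)|^2}{\mathcal K_{\alpha,\beta}(|z|^2)}\,d\mu_{\alpha,\beta}(w)$, $z\in\mathbb D$; it is well defined for $f\in L^1(\mathbb D,\mu_{\alpha,\beta})$. Mean oscillation: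 for $f\in L^2(\mathbb D,\mu_{\alpha,\beta})$, $$MO(f)(z)=\left(\mathbb B_{\alpha,\beta}(|f|^2)(z)-|\mathbb B_{\alpha,\beta}f(z)|^2\right)^{1/2},\qquad z\in\mathbb D,$$ equivalently $$(MO(f)(z))^2=\frac{1}{2\mathcal K_{\alpha,\beta}(|z|^2)^2}\int_{\mathbb D}\int_{\mathbb D}|f(u)-f(v)|^2|\mathcal K_{\alpha,\beta}(z\overline u)|^2|\mathcal K_{\alpha,\beta}(z\overline v)|^2d\mu_{\alpha,\beta}(u)d\mu_{\alpha,\beta}(v).$$ Put $\|f\|_{BMO}=\sup_{z\in\mathbb D}MO(f)(z)$; $BMO$ is the set of $f\in L^2(\mathbb D,\mu_{\alpha,\beta})$ with $\|f\|_{BMO}<\infty$. Modified Bergman-Poincaré metric: the function $\kappa_{\alpha,\beta}(z)=\log \mathcal K_{\alpha,\beta}(|z|^2)$ is $C^\infty$ and subharmonic on $\mathbb D$. Let $\varrho_{\alpha,\beta}\ge0$ be defined by $\varrho_{\alpha,\beta}^2(z)=\frac{\partial^2\kappa_{\alpha,\beta}}{\partial z\partial\overline z}(z)$. For a piecewise continuously differentiable curve $\gamma:[0,1]\to\mathbb D$ let $\ell_{\alpha,\beta}(\gamma)=\int_0^1\varrho_{\alpha,\beta}(\gamma(s))|\gamma'(s)|\,ds$, and let $\mathbf d_{\alpha,\beta}(z,w)=\inf\ell_{\alpha,\beta}(\gamma)$ over all such curves with $\gamma(0)=z$, $\gamma(1)=w$. *)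

theory Defs
  imports "HOL-Analysis.Analysis"
begin

text \<open>
  The unit disc is \<^term>\<open>ball (0::complex) 1\<close>; throughout, \<open>\<alpha> > -1\<close> and \<open>-1 < \<beta> \<le> 0\<close> are the
  intended parameters. The factor \<^term>\<open>pi\<close> in the density comes from \<open>dA = dx dy / \<pi>\<close>.
\<close>

definition mu :: "real \<Rightarrow> real \<Rightarrow> complex measure" where
  "mu \<alpha> \<beta> = density (lebesgue_on (ball 0 1))
     (\<lambda>z. ennreal (cmod z powr (2 * \<beta>) * (1 - (cmod z)\<^sup>2) powr \<alpha> / (Beta (\<alpha> + 1) (\<beta> + 1) * pi)))"

text \<open>
  \<open>{}\<^sub>2F\<^sub>1(1, \<alpha>+\<beta>+2; \<beta>+1; \<xi>)\<close>. Polymorphic, so that it applies both to complex arguments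
  \<open>w * cnj z\<close> and, with a real value, to \<open>\<bar>z\<bar>\<^sup>2\<close>.
\<close>

definition K :: "real \<Rightarrow> real \<Rightarrow> 'a \<Rightarrow> 'a::{real_normed_field, banach}" where
  "K \<alpha> \<beta> \<xi> = (\<Sum>n. of_real (pochhammer (\<alpha> + \<beta> + 2) n / pochhammer (\<beta> + 1) n) * \<xi> ^ n)"

definition berezin ::
  "real \<Rightarrow> real \<Rightarrow> (complex \<Rightarrow> 'a::{banach, second_countable_topology}) \<Rightarrow> complex \<Rightarrow> 'a" where
  "berezin \<alpha> \<beta> f z =
     (\<integral>w. ((cmod (K \<alpha> \<beta> (w * cnj z)))\<^sup>2 / K \<alpha> \<beta> ((cmod z)\<^sup>2)) *\<^sub>R f w \<partial>mu \<alpha> \<beta>)"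

definition L2 :: "real \<Rightarrow> real \<Rightarrow> (complex \<Rightarrow> complex) set" where
  "L2 \<alpha> \<beta> = {f. f \<in> borel_measurable (mu \<alpha> \<beta>) \<and> integrable (mu \<alpha> \<beta>) (\<lambda>z. (cmod (f z))\<^sup>2)}"

definition MO :: "real \<Rightarrow> real \<Rightarrow> (complex \<Rightarrow> complex) \<Rightarrow> complex \<Rightarrow> real" where
  "MO \<alpha> \<beta> f z = sqrt (berezin \<alpha> \<beta> (\<lambda>w. (cmod (f w))\<^sup>2) z - (cmod (berezin \<alpha> \<beta> f z))\<^sup>2)"

definition BMO_norm :: "real \<Rightarrow> real \<Rightarrow> (complex \<Rightarrow> complex) \<Rightarrow> real" where
  "BMO_norm \<alpha> \<beta> f = (SUP z\<in>ball 0 1. MO \<alpha> \<beta> f z)"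

text \<open>
  Since \<^const>\<open>BMO_norm\<close> is a real supremum, its finiteness is expressed by \<^const>\<open>bdd_above\<close>.
\<close>

definition BMO :: "real \<Rightarrow> real \<Rightarrow> (complex \<Rightarrow> complex) set" where
  "BMO \<alpha> \<beta> = {f \<in> L2 \<alpha> \<beta>. bdd_above (MO \<alpha> \<beta> f ` ball 0 1)}"

text \<open>
  Wirtinger derivatives: \<open>\<partial>/\<partial>z = (\<partial>/\<partial>x - \<i> \<partial>/\<partial>y) / 2\<close> and \<open>\<partial>/\<partial>z\<^sup>* = (\<partial>/\<partial>x + \<i> \<partial>/\<partial>y) / 2\<close>, where the
  partial derivatives are the values of the real derivative in the directions \<open>1\<close> and \<open>\<i>\<close>.
\<close>

definition d_z :: "(complex \<Rightarrow> complex) \<Rightarrow> complex \<Rightarrow> complex" where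
  "d_z f z = (frechet_derivative f (at z) 1 - \<i> * frechet_derivative f (at z) \<i>) / 2"

definition d_zbar :: "(complex \<Rightarrow> complex) \<Rightarrow> complex \<Rightarrow> complex" where
  "d_zbar f z = (frechet_derivative f (at z) 1 + \<i> * frechet_derivative f (at z) \<i>) / 2"

definition kappa :: "real \<Rightarrow> real \<Rightarrow> complex \<Rightarrow> real" where
  "kappa \<alpha> \<beta> z = ln (K \<alpha> \<beta> ((cmod z)\<^sup>2))"

text \<open>
  As \<^const>\<open>kappa\<close> is real-valued, smooth and subharmonic on the disc, the second derivative below is
  real and nonnegative there; \<^const>\<open>Re\<close> only adjusts the type.
\<close>

definition rho :: "real \<Rightarrow> real \<Rightarrow> complex \<Rightarrow> real" where
  "rho \<alpha> \<beta> z = sqrt (Re (d_z (d_zbar (\<lambda>w. complex_of_real (kappa \<alpha> \<beta> w))) z))"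

text \<open>
  The library's \<^const>\<open>valid_path\<close> asks for a continuous curve that is continuously differentiable
  off a finite set, but lets the derivative be unbounded near the exceptional points, so
  such a curve may have infinite length. Piecewise \<open>C\<^sup>1\<close> in the usual sense also requires the one-sided
  limits of the derivative.
\<close>

definition piecewise_C1_curve :: "(real \<Rightarrow> complex) \<Rightarrow> bool" where
  "piecewise_C1_curve \<gamma> \<longleftrightarrow> valid_path \<gamma> \<and>
     (\<forall>t\<in>{0..<1}. \<exists>l. ((\<lambda>s. vector_derivative \<gamma> (at s)) \<longlongrightarrow> l) (at_right t)) \<and>
     (\<forall>t\<in>{0<..1}. \<exists>l. ((\<lambda>s. vector_derivative \<gamma> (at s)) \<longlongrightarrow> l) (at_left t))"

definition curve_length :: "real \<Rightarrow> real \<Rightarrow> (real \<Rightarrow> complex) \<Rightarrow> real" where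
  "curve_length \<alpha> \<beta> \<gamma> =
     integral {0..1} (\<lambda>s. rho \<alpha> \<beta> (\<gamma> s) * cmod (vector_derivative \<gamma> (at s)))"

definition bp_dist :: "real \<Rightarrow> real \<Rightarrow> complex \<Rightarrow> complex \<Rightarrow> real" where
  "bp_dist \<alpha> \<beta> z w =
     Inf {curve_length \<alpha> \<beta> \<gamma> | \<gamma>.
            piecewise_C1_curve \<gamma> \<and> path_image \<gamma> \<subseteq> ball 0 1 \<and> pathstart \<gamma> = z \<and> pathfinish \<gamma> = w}"

end

theory Submission
  imports Defs
begin

text \<open>
  Write \<open>k\<^sub>z\<close> for the reproducing kernel at \<open>z\<close> normalised in \<open>L\<^sup>2(\<mu>)\<close>, and \<open>B\<close> for the Berezin
  transform, so that \<open>Bf(z) = \<integral> f \<bar>k\<^sub>z\<bar>\<^sup>2 d\<mu>\<close>. Since \<open>\<bar>k\<^sub>z\<bar>\<^sup>2\<close> and \<open>\<bar>k\<^sub>w\<bar>\<^sup>2\<close> have integral 1, the constant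
  \<open>Bf(z)\<close> may be subtracted from \<open>f\<close> in \<open>Bf(z) - Bf(w) = \<integral> f (\<bar>k\<^sub>z\<bar>\<^sup>2 - \<bar>k\<^sub>w\<bar>\<^sup>2) d\<mu>\<close>, and the
  Cauchy--Schwarz inequality gives \<open>\<Delta> \<le> \<delta> (2 M + \<Delta>)\<close>, where \<open>\<Delta> = \<bar>Bf(z) - Bf(w)\<bar>\<close>, \<open>M\<close> is the BMO norm
  and \<open>\<delta>\<close> is the \<open>L\<^sup>2\<close> distance of \<open>k\<^sub>z\<close> and \<open>k\<^sub>w\<close> after aligning their phases; thus
  \<open>\<delta>\<^sup>2 = 2 - 2 \<bar>\<langle>k\<^sub>z, k\<^sub>w\<rangle>\<bar>\<close>. A Gram determinant computation shows that \<open>\<delta> / \<bar>z - w\<bar>\<close> tends to \<open>\<rho>(p)\<close> as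
  \<open>z\<close> and \<open>w\<close> tend to \<open>p\<close>. So \<open>Bf\<close> is Lipschitz near \<open>p\<close> with a constant arbitrarily close to
  \<open>2 M \<rho>(p)\<close>, and this bound integrates along curves; \<open>Bf\<close> is never differentiated.
\<close>

section \<open>Lebesgue measure on the disc\<close>

text \<open>
  As in the uniqueness proof for Haar measure: with \<open>g\<close> the indicator of the unit ball, Fubini and
  translation invariance turn \<open>(\<integral> f(T u) du) (\<integral> g)\<close> into \<open>(\<integral> f) (\<integral> g)\<close>. This avoids determinants,
  which the library only provides for \<open>real ^ 'n\<close>.
\<close>

lemma nn_integral_lborel_orthogonal_transformation:
  fixes T :: "'a::euclidean_space \<Rightarrow> 'a"
  assumes T: "orthogonal_transformation T" and [measurable]: "f \<in> borel_measurable borel"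
  shows "(\<integral>\<^sup>+u. f (T u) \<partial>lborel) = (\<integral>\<^sup>+u. f u \<partial>lborel)"
proof -
  define g :: "'a \<Rightarrow> ennreal" where "g = indicator (ball 0 1)"
  have [measurable]: "g \<in> borel_measurable borel" unfolding g_def by (rule borel_measurable_indicator) simp
  have lin: "linear T" using T by (simp add: orthogonal_transformation_linear)
  have [measurable]: "T \<in> borel_measurable borel"
    using lin by (intro borel_measurable_continuous_onI linear_continuous_on) (simp add: linear_conv_bounded_linear)
  have trans: "(\<integral>\<^sup>+u. h (u + a) \<partial>lborel) = (\<integral>\<^sup>+u. h u \<partial>lborel)"
    if [measurable]: "h \<in> borel_measurable borel" for h :: "'a \<Rightarrow> ennreal" and a
  proof -
    have "(\<integral>\<^sup>+u. h (u + a) \<partial>lborel) = (\<integral>\<^sup>+u. h (a + u) \<partial>lborel)" by (simp add: add.commute)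
    also have "\<dots> = (\<integral>\<^sup>+u. h u \<partial>distr lborel borel ((+) a))" by (subst nn_integral_distr) auto
    finally show ?thesis by (simp add: lborel_distr_plus)
  qed
  obtain S where S: "\<And>y. T (S y) = y" using orthogonal_transformation_surj[OF T] by (metis surj_def)
  have gT: "g (- T u) = g u" for u
    using T by (simp add: g_def indicator_def orthogonal_transformation_norm)
  \<comment> \<open>Needed at the end, where the integral of \<open>g\<close> is cancelled.\<close>
  have fin: "(\<integral>\<^sup>+u. g u \<partial>lborel) \<noteq> 0" "(\<integral>\<^sup>+u. g u \<partial>lborel) \<noteq> \<infinity>"
    by (simp_all add: g_def emeasure_ball unit_ball_vol_def Gamma_real_pos
          ennreal_zero_less_top less_imp_neq[symmetric] divide_pos_pos)
  have "(\<integral>\<^sup>+u. f (T u) \<partial>lborel) * (\<integral>\<^sup>+y. g y \<partial>lborel)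
      = (\<integral>\<^sup>+u. (\<integral>\<^sup>+y. f (T u) * g (y + - T u) \<partial>lborel) \<partial>lborel)"
    by (subst nn_integral_cmult, measurable, subst trans, measurable, subst nn_integral_multc) auto
  also have "\<dots> = (\<integral>\<^sup>+y. (\<integral>\<^sup>+u. f (T u) * g (y + - T u) \<partial>lborel) \<partial>lborel)"
    by (rule lborel_pair.Fubini'[symmetric]) measurable
  \<comment> \<open>The inner variable is shifted by a preimage \<open>S y\<close> of
    \<open>y\<close>. Since \<open>T (u + S y) = T u + y\<close>, the variable \<open>y\<close>
    leaves the argument of \<open>g\<close> and enters that of \<open>f\<close>.\<close>
  also have "\<dots> = (\<integral>\<^sup>+y. (\<integral>\<^sup>+u. f (T (u + S y)) * g (y + - T (u + S y)) \<partial>lborel) \<partial>lborel)"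
    by (intro nn_integral_cong trans[symmetric]) measurable
  also have "\<dots> = (\<integral>\<^sup>+y. (\<integral>\<^sup>+u. f (y + T u) * g u \<partial>lborel) \<partial>lborel)"
    by (simp add: linear_add[OF lin] S gT add.commute)
  also have "\<dots> = (\<integral>\<^sup>+u. (\<integral>\<^sup>+y. f (y + T u) * g u \<partial>lborel) \<partial>lborel)"
    by (rule lborel_pair.Fubini') measurable
  also have "\<dots> = (\<integral>\<^sup>+u. f u \<partial>lborel) * (\<integral>\<^sup>+y. g y \<partial>lborel)"
    by (subst nn_integral_multc, measurable, subst trans, measurable, subst nn_integral_cmult) auto
  finally show ?thesis using fin by (simp add: mult.commute[of _ "integral\<^sup>N lborel g"] ennreal_mult_cancel_left)
qed

lemma distr_lborel_orthogonal_transformation: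
  fixes T :: "'a::euclidean_space \<Rightarrow> 'a"
  assumes T: "orthogonal_transformation T"
  shows "distr lborel borel T = lborel"
proof (rule measure_eqI)
  have [measurable]: "T \<in> borel_measurable borel"
    using orthogonal_transformation_linear[OF T]
    by (intro borel_measurable_continuous_onI linear_continuous_on) (simp add: linear_conv_bounded_linear)
  fix A assume "A \<in> sets (distr lborel borel T)"
  then have [measurable]: "A \<in> sets borel" by simp
  have "emeasure (distr lborel borel T) A = (\<integral>\<^sup>+u. indicator A u \<partial>distr lborel borel T)"
    by simp
  also have "\<dots> = (\<integral>\<^sup>+u. indicator A (T u) \<partial>lborel)"
    by (rule nn_integral_distr) auto
  also have "\<dots> = (\<integral>\<^sup>+u. indicator A u \<partial>lborel)"
    by (rule nn_integral_lborel_orthogonal_transformation[OF T]) simp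
  finally show "emeasure (distr lborel borel T) A = emeasure lborel A" by simp
qed simp

text \<open>The annulus \<open>x < (cmod z)\<^sup>2 < 1\<close> has area
  \<open>pi * (1 - x)\<close>, linear in \<open>x\<close>, so the squared modulus is uniformly
  distributed. This does the work of polar coordinates for radial integrands.\<close>

lemma distr_disc_cmod_square:
  "distr (restrict_space lborel (ball (0::complex) 1)) borel (\<lambda>z. (cmod z)\<^sup>2)
     = density lborel (\<lambda>t. ennreal pi * indicator {0..<1} t)" (is "?M = ?N")
proof (rule measure_eqI_lessThan)
  fix x :: real
  have N: "emeasure ?N {x<..} = ennreal (pi * (if x < 0 then 1 else if x < 1 then 1 - x else 0))"
  proof -
    have "emeasure ?N {x<..} = (\<integral>\<^sup>+t. ennreal pi * indicator ({0..<1} \<inter> {x<..}) t \<partial>lborel)"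
      by (subst emeasure_density) (auto simp: indicator_inter_arith mult.assoc)
    also have "\<dots> = ennreal pi * emeasure lborel ({0..<1} \<inter> {x<..})"
      by (subst nn_integral_cmult_indicator) auto
    also have "{0..<1} \<inter> {x<..} = (if x < 0 then {0..<1} else if x < 1 then {x<..<1} else {})"
      by auto
    finally show ?thesis by (auto simp: ennreal_mult[symmetric])
  qed
  have M: "emeasure ?M {x<..} = emeasure lborel ({z. x < (cmod z)\<^sup>2} \<inter> ball 0 1)"
    by (subst emeasure_distr)
      (auto simp: space_restrict_space vimage_def emeasure_restrict_space measurable_restrict_space1 intro!: arg_cong[where f = "emeasure lborel"])
  have vol: "emeasure lborel (ball (0::complex) r) = ennreal (pi * r^2)"
    "emeasure lborel (cball (0::complex) r) = ennreal (pi * r^2)" if "r \<ge> 0" for r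
    using that by (simp_all add: emeasure_ball emeasure_cball unit_ball_vol_2)
  have M2: "emeasure ?M {x<..} = ennreal (pi * (if x < 0 then 1 else if x < 1 then 1 - x else 0))"
  proof -
    consider "x < 0" | "0 \<le> x" "x < 1" | "x \<ge> 1" by linarith
    then show ?thesis
    proof cases
      case 1
      then have "{z. x < (cmod z)\<^sup>2} \<inter> ball 0 1 = ball 0 1"
        by (auto intro: less_le_trans[OF _ zero_le_power2])
      then show ?thesis using 1 vol(1)[of 1] by (simp add: M)
    next
      case 2
      have iff: "cmod z \<le> sqrt x \<longleftrightarrow> (cmod z)\<^sup>2 \<le> x" for z
        by (metis norm_ge_zero real_sqrt_abs abs_of_nonneg real_sqrt_le_iff)
      have eq: "{z. x < (cmod z)\<^sup>2} \<inter> ball 0 1 = ball 0 1 - cball (0::complex) (sqrt x)"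
        by (auto simp: not_le[symmetric] iff)
      have "cball (0::complex) (sqrt x) \<subseteq> ball 0 1"
        using 2 real_sqrt_lt_1_iff[of x] by (force simp del: real_sqrt_lt_1_iff)
      then have "emeasure lborel (ball 0 1 - cball (0::complex) (sqrt x))
          = emeasure lborel (ball (0::complex) 1) - emeasure lborel (cball (0::complex) (sqrt x))"
        using 2 by (intro emeasure_Diff) (auto simp: vol)
      also have "\<dots> = ennreal (pi * (1 - x))"
        using 2 by (simp add: vol ennreal_minus algebra_simps)
      finally show ?thesis using 2 by (simp add: M eq)
    next
      case 3
      then have "{z. x < (cmod z)\<^sup>2} \<inter> ball 0 1 = {}"
        by (auto simp: power2_eq_square) (smt (verit) mult_left_le_one_le norm_ge_zero)
      then show ?thesis using 3 by (simp add: M)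
    qed
  qed
  show "emeasure ?M {x<..} < \<infinity>" by (simp add: M2)
  show "emeasure ?M {x<..} = emeasure ?N {x<..}" by (simp add: M2 N)
qed auto

text \<open>Iterates the functional equation \<open>(x + y) B(x + 1, y) = x B(x, y)\<close>. It will
  turn radial moments into ratios of Pochhammer symbols.\<close>

lemma Beta_plus_of_nat:
  fixes x y :: real
  assumes "x > 0" "y > 0"
  shows "Beta (x + of_nat n) y = Beta x y * (pochhammer x n / pochhammer (x + y) n)"
proof (induction n)
  case (Suc n)
  have "(x + y + n) * Beta (x + n + 1) y = (x + n) * Beta (x + n) y"
    using Beta_plus1_left[of "x + n" y] assms
    by (simp add: algebra_simps) (metis add_nonneg_pos nonpos_Ints_nonpos not_le of_nat_0_le_iff add.commute)
  moreover have "x + y + n > 0" using assms by linarith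
  ultimately have "Beta (x + n + 1) y = (x + n) / (x + y + n) * Beta (x + n) y"
    by (simp add: field_simps)
  then show ?case using Suc by (simp add: pochhammer_Suc algebra_simps)
qed simp

section \<open>The weighted measure and its radial moments\<close>

locale weighted_disc =
  fixes \<alpha> \<beta> :: real
  assumes alpha: "\<alpha> > -1" and beta: "\<beta> > -1"
begin

abbreviation \<mu> :: "complex measure" where "\<mu> \<equiv> mu \<alpha> \<beta>"
abbreviation ker :: "'a \<Rightarrow> 'a::{real_normed_field, banach}" where "ker \<equiv> K \<alpha> \<beta>"

definition coef :: "nat \<Rightarrow> real" where
  "coef n = pochhammer (\<alpha> + \<beta> + 2) n / pochhammer (\<beta> + 1) n"

lemma coef_pos: "coef n > 0"
  unfolding coef_def using alpha beta by (intro divide_pos_pos pochhammer_pos) auto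

lemma coef_0 [simp]: "coef 0 = 1"
  by (simp add: coef_def)

text \<open>The density in the variable \<open>t = (cmod z)\<^sup>2\<close>, in which radial moments
  are Beta integrals.\<close>

definition weight :: "real \<Rightarrow> real" where
  "weight t = t powr \<beta> * (1 - t) powr \<alpha> / (Beta (\<alpha> + 1) (\<beta> + 1) * pi)"

lemma weight_measurable [measurable]: "weight \<in> borel_measurable borel"
  unfolding weight_def by measurable

lemma Beta_pos: "Beta (\<alpha> + 1) (\<beta> + 1) > 0"
  using alpha beta by (simp add: Beta_def Gamma_real_pos)

lemma weight_nonneg: "weight t \<ge> 0"
  using Beta_pos by (simp add: weight_def)

lemma mu_eq: "\<mu> = density (lebesgue_on (ball 0 1)) (\<lambda>z. ennreal (weight ((cmod z)\<^sup>2)))"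
proof -
  \<comment> \<open>At the origin both sides are \<open>0\<close>, by the convention
    \<open>0 powr x = 0\<close>.\<close>
  have "(cmod z)\<^sup>2 powr \<beta> = cmod z powr (2 * \<beta>)" for z :: complex
  proof (cases "z = 0")
    case False
    then have "(cmod z)\<^sup>2 = cmod z powr 2" by simp
    then show ?thesis by (simp only: powr_powr)
  qed simp
  then show ?thesis by (simp add: mu_def weight_def)
qed

lemma space_mu [simp]: "space \<mu> = ball 0 1"
  by (simp add: mu_eq space_restrict_space)

lemma borel_measurable_muI:
  assumes "f \<in> borel_measurable borel"
  shows "f \<in> borel_measurable \<mu>"
proof -
  have "f \<in> borel_measurable lebesgue" using assms by (simp add: measurable_completion)
  then show ?thesis by (simp add: mu_eq measurable_restrict_space1)
qed

lemma continuous_on_measurable_mu: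
  fixes f :: "complex \<Rightarrow> 'b::euclidean_space"
  assumes "continuous_on (ball 0 1) f"
  shows "f \<in> borel_measurable \<mu>"
  using continuous_imp_measurable_on_sets_lebesgue[OF assms]
  by (simp add: mu_eq)

text \<open>Removes density, restriction and completion, so that pushforward results for
  \<open>lborel\<close> apply to Borel integrands.\<close>

lemma nn_integral_mu:
  assumes [measurable]: "f \<in> borel_measurable borel"
  shows "(\<integral>\<^sup>+z. f z \<partial>\<mu>)
     = (\<integral>\<^sup>+z. ennreal (weight ((cmod z)\<^sup>2)) * f z * indicator (ball 0 1) z \<partial>lborel)"
proof -
  have [measurable]: "f \<in> borel_measurable lebesgue" "(\<lambda>z. ennreal (weight ((cmod z)\<^sup>2))) \<in> borel_measurable lebesgue"
    by (auto intro!: measurable_completion)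
  have "(\<integral>\<^sup>+z. f z \<partial>\<mu>) = (\<integral>\<^sup>+z. ennreal (weight ((cmod z)\<^sup>2)) * f z \<partial>lebesgue_on (ball 0 1))"
    unfolding mu_eq by (subst nn_integral_density) (auto intro!: measurable_restrict_space1)
  also have "\<dots> = (\<integral>\<^sup>+z. ennreal (weight ((cmod z)\<^sup>2)) * f z * indicator (ball 0 1) z \<partial>lebesgue)"
    by (subst nn_integral_restrict_space) auto
  also have "\<dots> = (\<integral>\<^sup>+z. ennreal (weight ((cmod z)\<^sup>2)) * f z * indicator (ball 0 1) z \<partial>lborel)"
    by (subst nn_integral_completion) auto
  finally show ?thesis .
qed

text \<open>With \<open>t = (cmod z)\<^sup>2\<close> the integral becomes \<open>B(\<beta> + 1 + k,
  \<alpha> + 1) / B(\<alpha> + 1, \<beta> + 1)\<close>. The kernel coefficients are the reciprocals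
  of these ratios, which is what makes \<open>ker\<close> reproducing.\<close>

lemma nn_integral_moment:
  "(\<integral>\<^sup>+z. ennreal (((cmod z)\<^sup>2) ^ k) \<partial>\<mu>) = ennreal (1 / coef k)"
proof -
  define h where "h t = ennreal (weight t * t ^ k)" for t
  have [measurable]: "h \<in> borel_measurable borel" unfolding h_def by measurable
  let ?B = "Beta (\<alpha> + 1) (\<beta> + 1)"
  have *: "weight t * t ^ k = 1 / (?B * pi) * (t powr ((\<beta> + 1 + k) - 1) * (1 - t) powr ((\<alpha> + 1) - 1))"
    if "t \<ge> 0" for t
    using that by (cases "t = 0") (auto simp: weight_def powr_add powr_realpow)
  have "((\<lambda>t. t powr ((\<beta> + 1 + k) - 1) * (1 - t) powr ((\<alpha> + 1) - 1)) has_integral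
      Beta (\<beta> + 1 + k) (\<alpha> + 1)) {0..1}"
    using alpha beta by (intro has_integral_Beta_real) auto
  then have "((\<lambda>t. 1 / (?B * pi) * (t powr ((\<beta> + 1 + k) - 1) * (1 - t) powr ((\<alpha> + 1) - 1))) has_integral
      1 / (?B * pi) * Beta (\<beta> + 1 + k) (\<alpha> + 1)) {0..1}"
    by (rule has_integral_mult_right)
  then have "((\<lambda>t. weight t * t ^ k) has_integral 1 / (?B * pi) * Beta (\<beta> + 1 + k) (\<alpha> + 1)) {0..1}"
    by (rule has_integral_eq[rotated]) (use * in auto)
  moreover have "1 / (?B * pi) * Beta (\<beta> + 1 + k) (\<alpha> + 1) = 1 / coef k / pi"
    using alpha beta Beta_pos Beta_plus_of_nat[of "\<beta> + 1" "\<alpha> + 1" k]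
    by (simp add: coef_def Beta_commute[of "1 + \<alpha>"] add_ac)
  ultimately have int: "((\<lambda>t. weight t * t ^ k) has_integral 1 / coef k / pi) {0..1}" by simp
  have "(\<integral>\<^sup>+z. ennreal (((cmod z)\<^sup>2) ^ k) \<partial>\<mu>)
      = (\<integral>\<^sup>+z. h ((cmod z)\<^sup>2) * indicator (ball 0 1) z \<partial>lborel)"
    by (subst nn_integral_mu) (auto simp: h_def ennreal_mult'[OF weight_nonneg, symmetric] mult.assoc)
  also have "\<dots> = (\<integral>\<^sup>+z. h ((cmod z)\<^sup>2) \<partial>restrict_space lborel (ball (0::complex) 1))"
    by (subst nn_integral_restrict_space) auto
  also have "\<dots> = (\<integral>\<^sup>+t. h t \<partial>density lborel (\<lambda>t. ennreal pi * indicator {0..<1} t))"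
    by (subst distr_disc_cmod_square[symmetric], subst nn_integral_distr)
       (auto intro!: measurable_restrict_space1)
  also have "\<dots> = (\<integral>\<^sup>+t. ennreal pi * (indicator {0..<1} t * h t) \<partial>lborel)"
    by (subst nn_integral_density) (auto simp: mult.assoc)
  also have "\<dots> = ennreal pi * (\<integral>\<^sup>+t. indicator {0..<1} t * h t \<partial>lborel)"
    by (subst nn_integral_cmult) auto
  \<comment> \<open>Adding the endpoint changes no value: \<open>weight 1 = 0\<close>, because
    \<open>0 powr \<alpha> = 0\<close> for negative \<open>\<alpha>\<close> as well.\<close>
  also have "(\<integral>\<^sup>+t. indicator {0..<1} t * h t \<partial>lborel) = (\<integral>\<^sup>+t. ennreal (indicator {0..1} t * (weight t * t ^ k)) \<partial>lborel)"
    by (intro nn_integral_cong) (auto simp: h_def indicator_def weight_def)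
  also have "\<dots> = ennreal (1 / coef k / pi)"
    using nn_integral_has_integral_lebesgue[OF _ int] weight_nonneg by simp
  also have "ennreal pi * ennreal (1 / coef k / pi) = ennreal (1 / coef k)"
    using coef_pos[of k] by (simp add: ennreal_mult[symmetric])
  finally show ?thesis .
qed

lemma emeasure_space_mu: "emeasure \<mu> (space \<mu>) = 1"
  using nn_integral_moment[of 0] by simp

sublocale finite_measure \<mu>
  using emeasure_space_mu by (intro finite_measureI) simp

end

section \<open>Moments and the reproducing kernel\<close>

context weighted_disc
begin

lemma integral_mu:
  fixes f :: "complex \<Rightarrow> complex"
  assumes [measurable]: "f \<in> borel_measurable borel"
  shows "(\<integral>z. f z \<partial>\<mu>) = (\<integral>z. (indicator (ball 0 1) z * weight ((cmod z)\<^sup>2)) *\<^sub>R f z \<partial>lborel)"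
proof -
  have [measurable]: "ball (0::complex) 1 \<in> sets borel" by simp
  have [measurable]: "f \<in> borel_measurable lebesgue" "(\<lambda>z. weight ((cmod z)\<^sup>2)) \<in> borel_measurable lebesgue"
    by (auto intro!: measurable_completion)
  have "(\<integral>z. f z \<partial>\<mu>) = (\<integral>z. weight ((cmod z)\<^sup>2) *\<^sub>R f z \<partial>lebesgue_on (ball 0 1))"
    unfolding mu_eq by (subst integral_density) (auto intro!: measurable_restrict_space1 weight_nonneg)
  also have "\<dots> = (\<integral>z. indicator (ball 0 1) z *\<^sub>R weight ((cmod z)\<^sup>2) *\<^sub>R f z \<partial>lebesgue)"
    by (subst integral_restrict_space) auto
  also have "\<dots> = (\<integral>z. indicator (ball 0 1) z *\<^sub>R weight ((cmod z)\<^sup>2) *\<^sub>R f z \<partial>lborel)"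
    by (subst integral_completion) auto
  finally show ?thesis by simp
qed

text \<open>Multiplication by a unimodular number is an orthogonal map, and both the disc and the
  density depend on \<open>cmod z\<close> only.\<close>

lemma integral_mu_rotate:
  fixes f :: "complex \<Rightarrow> complex"
  assumes [measurable]: "f \<in> borel_measurable borel" and c: "cmod c = 1"
  shows "(\<integral>z. f (c * z) \<partial>\<mu>) = (\<integral>z. f z \<partial>\<mu>)"
proof -
  have [measurable]: "ball (0::complex) 1 \<in> sets borel" by simp
  let ?F = "\<lambda>z. (indicator (ball 0 1) z * weight ((cmod z)\<^sup>2)) *\<^sub>R f z"
  have "orthogonal_transformation ((*) c)"
    by (simp add: orthogonal_transformation c norm_mult linear_times)
  then have eq: "distr lborel borel ((*) c) = lborel"
    by (rule distr_lborel_orthogonal_transformation)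
  have "(\<integral>z. f (c * z) \<partial>\<mu>) = (\<integral>z. ?F (c * z) \<partial>lborel)"
    by (subst integral_mu) (auto simp: norm_mult c indicator_def)
  also have "\<dots> = (\<integral>z. ?F z \<partial>distr lborel borel ((*) c))"
    by (subst integral_distr) auto
  also have "\<dots> = (\<integral>z. f z \<partial>\<mu>)"
    by (subst eq, subst integral_mu) auto
  finally show ?thesis .
qed

lemma integrable_muI:
  fixes f :: "complex \<Rightarrow> 'b::{banach, second_countable_topology}"
  assumes "f \<in> borel_measurable \<mu>" "\<And>u. cmod u < 1 \<Longrightarrow> norm (f u) \<le> B"
  shows "integrable \<mu> f"
  using assms by (intro integrable_const_bound[where B = B]) auto

text \<open>On the diagonal this is a radial moment. Off the diagonal, a suitable rotation shows
  that the integral equals its own negative.\<close>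

lemma integral_moment:
  "(\<integral>u. u ^ n * cnj u ^ m \<partial>\<mu>) = (if n = m then of_real (1 / coef n) else 0)"
proof (cases "n = m")
  case True
  have "(\<integral>u. u ^ n * cnj u ^ m \<partial>\<mu>) = (\<integral>u. of_real (((cmod u)\<^sup>2) ^ n) \<partial>\<mu>)"
    unfolding True by (simp only: power_mult_distrib[symmetric] complex_norm_square[symmetric] of_real_power)
  also have "\<dots> = of_real (\<integral>u. ((cmod u)\<^sup>2) ^ n \<partial>\<mu>)"
    by (rule integral_complex_of_real)
  also have "(\<integral>u. ((cmod u)\<^sup>2) ^ n \<partial>\<mu>) = 1 / coef n"
    using coef_pos[of n]
    by (subst integral_eq_nn_integral) (auto simp: nn_integral_moment intro!: borel_measurable_muI)
  finally show ?thesis using True by simp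
next
  case False
  \<comment> \<open>The angle is chosen so that \<open>c ^ n * cnj c ^ m = cis pi = -1\<close>; the
    difference is taken in the reals, so either exponent may be the larger one.\<close>
  define c where "c = cis (pi / (real n - real m))"
  have "c ^ n * cnj c ^ m = cis (real n * (pi / (real n - real m)) - real m * (pi / (real n - real m)))"
    unfolding c_def cis_cnj Complex.DeMoivre cis_mult by (simp only: mult_minus_right diff_conv_add_uminus)
  also have "real n * (pi / (real n - real m)) - real m * (pi / (real n - real m)) = pi"
    using False by (simp add: diff_divide_distrib[symmetric] left_diff_distrib[symmetric])
  finally have c: "c ^ n * cnj c ^ m = -1" by simp
  have "(\<integral>u. u ^ n * cnj u ^ m \<partial>\<mu>) = (\<integral>u. (c * u) ^ n * cnj (c * u) ^ m \<partial>\<mu>)"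
    by (rule integral_mu_rotate[symmetric])
       (auto simp: c_def intro!: borel_measurable_continuous_onI continuous_intros)
  also have "\<dots> = (\<integral>u. (c ^ n * cnj c ^ m) * (u ^ n * cnj u ^ m) \<partial>\<mu>)"
    by (simp add: power_mult_distrib mult_ac)
  also have "\<dots> = - (\<integral>u. u ^ n * cnj u ^ m \<partial>\<mu>)"
    by (simp add: c)
  finally show ?thesis using False by simp
qed

section \<open>Convergence and bounds for the kernel series\<close>

lemma summable_coef_square:
  assumes "\<bar>r\<bar> < (1::real)"
  shows "summable (\<lambda>n. coef n * (real n + 1)\<^sup>2 * \<bar>r\<bar> ^ n)"
proof -
  have lim: "(\<lambda>n. (real n + a) / (real n + b)) \<longlonglongrightarrow> 1" for a b :: real
  proof -
    have "filterlim (\<lambda>n. real n + b) at_infinity sequentially"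
      using filterlim_tendsto_add_at_top[OF tendsto_const filterlim_real_sequentially, of b]
      by (intro filterlim_at_top_imp_at_infinity) (simp add: add.commute)
    then have "(\<lambda>n. 1 + (a - b) / (real n + b)) \<longlonglongrightarrow> 1 + 0"
      by (intro tendsto_add tendsto_const tendsto_divide_0[OF tendsto_const])
    moreover have "\<forall>\<^sub>F n in sequentially. real n > - b"
      using filterlim_real_sequentially by (simp add: filterlim_at_top_dense)
    then have "\<forall>\<^sub>F n in sequentially. 1 + (a - b) / (real n + b) = (real n + a) / (real n + b)"
      by eventually_elim (simp add: field_simps)
    ultimately show ?thesis by (simp add: tendsto_cong)
  qed
  \<comment> \<open>The factor \<open>(real n + 1)\<^sup>2\<close> makes room for two difference
    quotients of \<open>z ^ n\<close> later on. It does not change the limit \<open>1\<close> of the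
    ratios, hence not the radius of convergence.\<close>
  define g where "g n = coef n * (real n + 1)\<^sup>2" for n
  have g: "g n > 0" for n by (simp add: g_def coef_pos)
  have "g n / g (Suc n) = (real n + (\<beta> + 1)) / (real n + (\<alpha> + \<beta> + 2)) * ((real n + 1) / (real n + 2))\<^sup>2" for n
  proof -
    have "coef n / coef (Suc n) = (real n + (\<beta> + 1)) / (real n + (\<alpha> + \<beta> + 2))"
      using alpha beta pochhammer_pos[of "\<alpha> + \<beta> + 2" n] pochhammer_pos[of "\<beta> + 1" n]
      by (simp add: coef_def pochhammer_Suc add_ac)
    moreover have "g n / g (Suc n) = coef n / coef (Suc n) * ((real n + 1) / (real n + 2))\<^sup>2"
      by (simp add: g_def power_divide add_ac)
    ultimately show ?thesis by simp
  qed
  moreover have "(\<lambda>n. (real n + (\<beta> + 1)) / (real n + (\<alpha> + \<beta> + 2)) * ((real n + 1) / (real n + 2))\<^sup>2) \<longlonglongrightarrow> 1 * 1\<^sup>2"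
    by (intro tendsto_mult tendsto_power lim)
  ultimately have "(\<lambda>n. norm (g n) / norm (g (Suc n))) \<longlonglongrightarrow> 1"
    using g by (simp add: less_imp_le)
  then have "conv_radius g = ereal 1"
    using g by (intro conv_radius_ratio_limit_nonzero) (auto simp: less_imp_neq[symmetric])
  then show ?thesis
    using abs_summable_in_conv_radius[of r g] assms g
    by (simp add: g_def norm_mult norm_power abs_mult power_abs less_imp_le coef_pos)
qed

lemma summable_coef:
  assumes "\<bar>r\<bar> < (1::real)"
  shows "summable (\<lambda>n. coef n * \<bar>r\<bar> ^ n)"
proof (rule summable_comparison_test'[OF summable_coef_square[OF assms], of 0])
  fix n
  have "coef n * 1 * \<bar>r\<bar> ^ n \<le> coef n * (real n + 1)\<^sup>2 * \<bar>r\<bar> ^ n"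
    by (intro mult_left_mono mult_right_mono) (auto simp: coef_pos less_imp_le)
  then show "norm (coef n * \<bar>r\<bar> ^ n) \<le> coef n * (real n + 1)\<^sup>2 * \<bar>r\<bar> ^ n"
    by (simp add: coef_pos less_imp_le abs_mult)
qed

lemma ker_def': "ker x = (\<Sum>n. of_real (coef n) * x ^ n)"
  by (simp add: K_def coef_def)

lemma summable_ker:
  fixes x :: "'a::{real_normed_field, banach}"
  assumes "norm x < 1"
  shows "summable (\<lambda>n. norm (of_real (coef n) * x ^ n))" "summable (\<lambda>n. of_real (coef n) * x ^ n)"
proof -
  show 1: "summable (\<lambda>n. norm (of_real (coef n) * x ^ n))"
    using summable_coef[of "norm x"] assms
    by (simp add: norm_mult norm_power coef_pos less_imp_le)
  then show "summable (\<lambda>n. of_real (coef n) * x ^ n)" by (rule summable_norm_cancel)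
qed

lemma ker_sums:
  fixes x :: "'a::{real_normed_field, banach}"
  assumes "norm x < 1"
  shows "(\<lambda>n. of_real (coef n) * x ^ n) sums ker x"
  unfolding ker_def' using summable_ker(2)[OF assms] by (rule summable_sums)

lemma continuous_on_ker:
  "continuous_on (ball 0 1) (ker :: 'a::{real_normed_field, banach} \<Rightarrow> 'a)"
proof (rule continuous_at_imp_continuous_on, rule ballI)
  fix x :: 'a assume "x \<in> ball 0 1"
  then obtain r where r: "norm x < r" "r < 1" using dense[of "norm x" 1] by auto
  then have "r \<ge> 0" using norm_ge_zero[of x] by linarith
  have "isCont (\<lambda>x. \<Sum>n. of_real (coef n) * x ^ n) x"
    by (rule isCont_powser[of _ "of_real r"]) (use r \<open>r \<ge> 0\<close> in \<open>auto intro!: summable_ker\<close>)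
  then show "isCont ker x" by (simp add: ker_def'[abs_def])
qed

text \<open>All coefficients are positive, so the triangle inequality majorises the series by its
  value at a real radius.\<close>

lemma norm_ker_le:
  fixes x :: "'a::{real_normed_field, banach}"
  assumes "norm x \<le> r" "r < 1"
  shows "norm (ker x) \<le> ker r"
proof -
  have r: "0 \<le> r" using assms(1) norm_ge_zero order_trans by blast
  have "norm (ker x) \<le> (\<Sum>n. norm (of_real (coef n) * x ^ n))"
    unfolding ker_def' using assms by (intro summable_norm summable_ker) auto
  also have "\<dots> \<le> ker r"
    unfolding ker_def'
    using assms r summable_ker(1)[of x] summable_ker(2)[of r]
    by (intro suminf_le) (auto simp: norm_mult norm_power coef_pos less_imp_le intro!: mult_left_mono power_mono)
  finally show ?thesis .
qed

lemma ker_ge_1: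
  assumes "0 \<le> r" "r < (1::real)"
  shows "ker r \<ge> 1"
  using sum_le_suminf[OF summable_ker(2)[of r], of "{0}"] assms
  by (auto simp: ker_def' coef_pos less_imp_le)

lemma ker_cnj: "cmod x < 1 \<Longrightarrow> cnj (ker x) = ker (cnj x)"
  using ker_sums[of "cnj x"] sums_cnj[THEN iffD2, OF ker_sums[of x]] sums_unique2
  by (fastforce)

lemma ker_of_real: "\<bar>r\<bar> < 1 \<Longrightarrow> ker (of_real r :: complex) = of_real (ker r)"
  using ker_sums[of "of_real r :: complex"] sums_of_real[OF ker_sums[of r], where 'a = complex] sums_unique2
  by fastforce

section \<open>Termwise integration and the reproducing property\<close>

lemma sums_integral_mu:
  fixes f :: "nat \<Rightarrow> complex \<Rightarrow> complex"
  assumes "\<And>n. f n \<in> borel_measurable \<mu>" "\<And>n u. cmod u < 1 \<Longrightarrow> cmod (f n u) \<le> B n" "summable B"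
  shows "(\<lambda>n. \<integral>u. f n u \<partial>\<mu>) sums (\<integral>u. (\<Sum>n. f n u) \<partial>\<mu>)"
proof (rule sums_integral)
  show int: "integrable \<mu> (f n)" for n using assms by (intro integrable_muI) auto
  show "AE u in \<mu>. summable (\<lambda>n. cmod (f n u))"
    using assms by (intro AE_I2 summable_comparison_test'[OF assms(3), of 0]) auto
  show "summable (\<lambda>n. \<integral>u. cmod (f n u) \<partial>\<mu>)"
  proof (rule summable_comparison_test'[OF assms(3), of 0])
    fix n
    \<comment> \<open>As \<open>\<mu>\<close> has total mass \<open>1\<close>, the uniform bound
      \<open>B n\<close> is also a bound for the \<open>L\<^sup>1\<close> norm.\<close>
    have "(\<integral>u. cmod (f n u) \<partial>\<mu>) \<le> (\<integral>u. B n \<partial>\<mu>)"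
      using int assms by (intro integral_mono) auto
    then show "norm (\<integral>u. cmod (f n u) \<partial>\<mu>) \<le> B n"
      using emeasure_space_mu by (simp add: measure_def)
  qed
qed

lemma kernel_norm_less: "cmod u < 1 \<Longrightarrow> cmod z < 1 \<Longrightarrow> cmod (u * cnj z) < 1"
  by (simp add: norm_mult) (smt (verit) mult_left_le norm_ge_zero)

lemma continuous_on_kernel:
  "cmod z < 1 \<Longrightarrow> continuous_on (ball 0 1) (\<lambda>u. ker (u * cnj z))"
  by (intro continuous_on_compose2[OF continuous_on_ker] continuous_intros)
     (auto intro!: kernel_norm_less)

lemma kernel_measurable:
  "cmod z < 1 \<Longrightarrow> (\<lambda>u. ker (u * cnj z)) \<in> borel_measurable \<mu>"
  by (intro continuous_on_measurable_mu continuous_on_kernel)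

lemma kernel_bounded:
  "cmod u < 1 \<Longrightarrow> cmod z < 1 \<Longrightarrow> cmod (ker (u * cnj z)) \<le> ker (cmod z)"
  by (intro norm_ker_le) (auto simp: norm_mult mult_left_le_one_le)

text \<open>The reproducing property for monomials: by orthogonality only the term
  \<open>m = n\<close> of the kernel series survives, and there \<open>coef n\<close> cancels the
  moment \<open>1 / coef n\<close>.\<close>

lemma integral_power_kernel:
  assumes w: "cmod w < 1"
  shows "(\<integral>u. u ^ n * cnj (ker (u * cnj w)) \<partial>\<mu>) = w ^ n"
proof -
  define f where "f m u = of_real (coef m) * w ^ m * (u ^ n * cnj u ^ m)" for m u
  have "(\<lambda>m. \<integral>u. f m u \<partial>\<mu>) sums (\<integral>u. (\<Sum>m. f m u) \<partial>\<mu>)"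
  proof (rule sums_integral_mu)
    show "f m \<in> borel_measurable \<mu>" for m unfolding f_def
      by (intro borel_measurable_muI borel_measurable_continuous_onI continuous_intros)
    show "cmod (f m u) \<le> coef m * cmod w ^ m" if "cmod u < 1" for m u
    proof -
      have "cmod u ^ n * cmod u ^ m \<le> 1 * 1" using that by (intro mult_mono power_le_one) auto
      then show ?thesis using mult_left_mono[of "cmod u ^ n * cmod u ^ m" 1 "coef m * cmod w ^ m"]
        by (simp add: f_def norm_mult norm_power coef_pos less_imp_le)
    qed
    show "summable (\<lambda>m. coef m * cmod w ^ m)" using summable_coef[of "cmod w"] w by simp
  qed
  moreover have "(\<integral>u. (\<Sum>m. f m u) \<partial>\<mu>) = (\<integral>u. u ^ n * cnj (ker (u * cnj w)) \<partial>\<mu>)"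
  proof (rule Bochner_Integration.integral_cong[OF refl])
    fix u assume "u \<in> space \<mu>"
    then have "cmod u < 1" by simp
    from ker_sums[OF kernel_norm_less[OF this w]]
    have "(\<lambda>m. cnj (of_real (coef m) * (u * cnj w) ^ m)) sums cnj (ker (u * cnj w))"
      by (simp only: sums_cnj)
    from sums_mult[OF this, of "u ^ n"]
    show "(\<Sum>m. f m u) = u ^ n * cnj (ker (u * cnj w))"
      by (intro sums_unique[symmetric]) (simp add: f_def power_mult_distrib mult_ac)
  qed
  moreover have "(\<integral>u. f m u \<partial>\<mu>) = (if m = n then w ^ n else 0)" for m
    using coef_pos[of n] by (auto simp: f_def integral_moment)
  ultimately show ?thesis using sums_unique2 sums_single[of n "\<lambda>m. w ^ n"] by fastforce
qed

text \<open>Expands the first kernel into powers of \<open>u\<close> and reproduces each of them at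
  \<open>w\<close>.\<close>

lemma integral_kernel_kernel:
  assumes z: "cmod z < 1" and w: "cmod w < 1"
  shows "(\<integral>u. ker (u * cnj z) * cnj (ker (u * cnj w)) \<partial>\<mu>) = ker (w * cnj z)"
proof -
  define f where "f n u = of_real (coef n) * cnj z ^ n * (u ^ n * cnj (ker (u * cnj w)))" for n u
  have "(\<lambda>n. \<integral>u. f n u \<partial>\<mu>) sums (\<integral>u. (\<Sum>n. f n u) \<partial>\<mu>)"
  proof (rule sums_integral_mu)
    show "f n \<in> borel_measurable \<mu>" for n
      unfolding f_def
      by (intro continuous_on_measurable_mu continuous_intros continuous_on_kernel w)
    show "cmod (f n u) \<le> (coef n * cmod z ^ n) * ker (cmod w)" if "cmod u < 1" for n u
    proof -
      have "cmod u ^ n * cmod (ker (u * cnj w)) \<le> 1 * ker (cmod w)"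
        using that w by (intro mult_mono power_le_one kernel_bounded) auto
      then show ?thesis using mult_left_mono[of "cmod u ^ n * cmod (ker (u * cnj w))" "ker (cmod w)" "coef n * cmod z ^ n"]
        by (simp add: f_def norm_mult norm_power coef_pos less_imp_le)
    qed
    show "summable (\<lambda>n. (coef n * cmod z ^ n) * ker (cmod w))"
      using summable_coef[of "cmod z"] z by (intro summable_mult2) simp
  qed
  moreover have "(\<integral>u. (\<Sum>n. f n u) \<partial>\<mu>) = (\<integral>u. ker (u * cnj z) * cnj (ker (u * cnj w)) \<partial>\<mu>)"
  proof (rule Bochner_Integration.integral_cong[OF refl])
    fix u assume "u \<in> space \<mu>"
    then have "cmod u < 1" by simp
    from sums_mult2[OF ker_sums[OF kernel_norm_less[OF this z]], of "cnj (ker (u * cnj w))"]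
    show "(\<Sum>n. f n u) = ker (u * cnj z) * cnj (ker (u * cnj w))"
      by (intro sums_unique[symmetric]) (simp add: f_def power_mult_distrib mult_ac)
  qed
  moreover have "(\<integral>u. f n u \<partial>\<mu>) = of_real (coef n) * (w * cnj z) ^ n" for n
    by (simp add: f_def integral_power_kernel[OF w] power_mult_distrib)
  ultimately show ?thesis
    using ker_sums[OF kernel_norm_less[OF w z]] sums_unique2 by fastforce
qed

end

section \<open>Mean oscillation and the Berezin transform\<close>

text \<open>The bound \<open>2 \<bar>g\<bar> \<bar>h\<bar> \<le> g\<^sup>2 + h\<^sup>2\<close> gives
  integrability. The inequality follows from the nonnegativity of the integral of
  \<open>(s * g x - t * h x)\<^sup>2\<close>, a quadratic form in \<open>s\<close> and
  \<open>t\<close>.\<close>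

lemma Cauchy_Schwarz_integral:
  fixes g h :: "'a \<Rightarrow> real"
  assumes [measurable]: "g \<in> borel_measurable M" "h \<in> borel_measurable M"
    and g: "integrable M (\<lambda>x. (g x)\<^sup>2)" and h: "integrable M (\<lambda>x. (h x)\<^sup>2)"
  shows "integrable M (\<lambda>x. g x * h x)"
    and "\<bar>\<integral>x. g x * h x \<partial>M\<bar> \<le> sqrt (\<integral>x. (g x)\<^sup>2 \<partial>M) * sqrt (\<integral>x. (h x)\<^sup>2 \<partial>M)"
proof -
  show gh: "integrable M (\<lambda>x. g x * h x)"
  proof (rule Bochner_Integration.integrable_bound[OF Bochner_Integration.integrable_add[OF g h]])
    show "AE x in M. norm (g x * h x) \<le> norm ((g x)\<^sup>2 + (h x)\<^sup>2)"
    proof (rule AE_I2)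
      fix x
      have "2 * \<bar>g x\<bar> * \<bar>h x\<bar> \<le> \<bar>g x\<bar>\<^sup>2 + \<bar>h x\<bar>\<^sup>2" by (rule sum_squares_bound)
      moreover have "0 \<le> \<bar>g x\<bar> * \<bar>h x\<bar>" by simp
      ultimately have "\<bar>g x\<bar> * \<bar>h x\<bar> \<le> (g x)\<^sup>2 + (h x)\<^sup>2" unfolding power2_abs by linarith
      then show "norm (g x * h x) \<le> norm ((g x)\<^sup>2 + (h x)\<^sup>2)" by (simp add: abs_mult)
    qed
  qed measurable
  define a b c where "a = (\<integral>x. (g x)\<^sup>2 \<partial>M)" and "b = (\<integral>x. (h x)\<^sup>2 \<partial>M)" and "c = (\<integral>x. g x * h x \<partial>M)"
  have ab: "a \<ge> 0" "b \<ge> 0" by (simp_all add: a_def b_def)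
  have quad: "0 \<le> s\<^sup>2 * a - 2 * s * t * c + t\<^sup>2 * b" for s t
  proof -
    have "0 \<le> (\<integral>x. (s * g x - t * h x)\<^sup>2 \<partial>M)" by simp
    also have "\<dots> = (\<integral>x. s\<^sup>2 * (g x)\<^sup>2 - 2 * s * t * (g x * h x) + t\<^sup>2 * (h x)\<^sup>2 \<partial>M)"
      by (intro Bochner_Integration.integral_cong) (auto simp: power2_diff power_mult_distrib)
    also have "\<dots> = s\<^sup>2 * a - 2 * s * t * c + t\<^sup>2 * b"
      using g h gh by (simp add: a_def b_def c_def)
    finally show ?thesis .
  qed
  have "c\<^sup>2 \<le> a * b"
  proof (cases "b = 0")
    case True
    have "c = 0"
    proof (rule ccontr)
      assume "c \<noteq> 0"
      \<comment> \<open>With \<open>b = 0\<close> and these parameters the form takes the value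
        \<open>a - 2 * (a + 1) < 0\<close>.\<close>
      then show False using quad[of 1 "(a + 1) / c"] True ab by simp
    qed
    then show ?thesis using True by simp
  next
    case False
    \<comment> \<open>At \<open>s = b\<close>, \<open>t = c\<close> the quadratic form factors in
      this way.\<close>
    have "0 \<le> b * (a * b - c\<^sup>2)"
      using quad[of b c] by (simp add: power2_eq_square algebra_simps)
    then show ?thesis using False ab by (simp add: zero_le_mult_iff)
  qed
  then have "\<bar>c\<bar> \<le> sqrt (a * b)" by (metis real_sqrt_abs real_sqrt_le_mono)
  then show "\<bar>\<integral>x. g x * h x \<partial>M\<bar> \<le> sqrt (\<integral>x. (g x)\<^sup>2 \<partial>M) * sqrt (\<integral>x. (h x)\<^sup>2 \<partial>M)"
    by (simp add: a_def b_def c_def real_sqrt_mult)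
qed

section \<open>Normalised kernels and their inner products\<close>

context weighted_disc
begin

text \<open>The unit vector \<open>k\<^sub>z\<close>: by the reproducing property the kernel at
  \<open>z\<close> has squared norm \<open>ker ((cmod z)\<^sup>2)\<close>.\<close>

definition nkernel :: "complex \<Rightarrow> complex \<Rightarrow> complex" where
  "nkernel z u = ker (u * cnj z) / of_real (sqrt (ker ((cmod z)\<^sup>2)))"

lemma ker_square_ge_1: "cmod z < 1 \<Longrightarrow> ker ((cmod z)\<^sup>2) \<ge> 1"
  by (intro ker_ge_1) (auto simp: power_less_one_iff)

lemma nkernel_measurable: "cmod z < 1 \<Longrightarrow> nkernel z \<in> borel_measurable \<mu>"
  unfolding nkernel_def[abs_def] using kernel_measurable[of z] by measurable

lemma nkernel_bounded:
  assumes "cmod u < 1" "cmod z < 1"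
  shows "cmod (nkernel z u) \<le> ker (cmod z)"
proof -
  have "cmod (nkernel z u) \<le> cmod (ker (u * cnj z))"
    using ker_square_ge_1[OF assms(2)]
    by (simp add: nkernel_def norm_divide divide_le_eq mult_ge1_I mult_le_cancel_left1)
  then show ?thesis using kernel_bounded[OF assms] by linarith
qed

lemma cmod_nkernel_square:
  "cmod z < 1 \<Longrightarrow> (cmod (nkernel z u))\<^sup>2 = (cmod (ker (u * cnj z)))\<^sup>2 / ker ((cmod z)\<^sup>2)"
  using ker_square_ge_1[of z] by (simp add: nkernel_def norm_divide power_divide)

lemma berezin_eq:
  "cmod z < 1 \<Longrightarrow> berezin \<alpha> \<beta> f z = (\<integral>u. (cmod (nkernel z u))\<^sup>2 *\<^sub>R f u \<partial>\<mu>)"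
  by (simp add: berezin_def cmod_nkernel_square)

lemma integrable_bounded_mult:
  fixes f :: "complex \<Rightarrow> 'b::{banach, second_countable_topology}"
  assumes f: "integrable \<mu> f" and g: "g \<in> borel_measurable \<mu>"
    and B: "\<And>u. cmod u < 1 \<Longrightarrow> \<bar>g u\<bar> \<le> B"
  shows "integrable \<mu> (\<lambda>u. g u *\<^sub>R f u)"
proof (rule Bochner_Integration.integrable_bound[OF integrable_scaleR_right[OF f, of B]])
  show "(\<lambda>u. g u *\<^sub>R f u) \<in> borel_measurable \<mu>" using f g by measurable
  show "AE u in \<mu>. norm (g u *\<^sub>R f u) \<le> norm (B *\<^sub>R f u)"
  proof (rule AE_I2)
    fix u assume "u \<in> space \<mu>"
    then have "\<bar>g u\<bar> \<le> \<bar>B\<bar>" using B[of u] by auto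
    then show "norm (g u *\<^sub>R f u) \<le> norm (B *\<^sub>R f u)" by (simp add: mult_right_mono)
  qed
qed

text \<open>For fixed \<open>z\<close> the normalised kernel is bounded on the disc. Hence the
  Berezin transform of an integrable function is a genuine integral and not the default value
  \<open>0\<close>.\<close>

lemma integrable_nkernel_square_mult:
  fixes f :: "complex \<Rightarrow> 'b::{banach, second_countable_topology}"
  assumes f: "integrable \<mu> f" and z: "cmod z < 1"
  shows "integrable \<mu> (\<lambda>u. (cmod (nkernel z u))\<^sup>2 *\<^sub>R f u)"
proof (rule integrable_bounded_mult[OF f])
  show "(\<lambda>u. (cmod (nkernel z u))\<^sup>2) \<in> borel_measurable \<mu>"
    using nkernel_measurable[OF z] by measurable
  show "\<bar>(cmod (nkernel z u))\<^sup>2\<bar> \<le> (ker (cmod z))\<^sup>2" if "cmod u < 1" for u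
    using power_mono[OF nkernel_bounded[OF that z], of 2] by simp
qed

lemma integrable_nkernel_nkernel:
  assumes z: "cmod z < 1" and w: "cmod w < 1"
  shows "integrable \<mu> (\<lambda>u. nkernel z u * cnj (nkernel w u))"
proof (rule integrable_muI)
  have "nkernel z \<in> borel_measurable \<mu>" "nkernel w \<in> borel_measurable \<mu>"
    using z w by (auto intro: nkernel_measurable)
  moreover have "cnj \<in> borel_measurable borel"
    by (intro borel_measurable_continuous_onI continuous_intros)
  ultimately show "(\<lambda>u. nkernel z u * cnj (nkernel w u)) \<in> borel_measurable \<mu>" by measurable
  show "cmod (nkernel z u * cnj (nkernel w u)) \<le> ker (cmod z) * ker (cmod w)" if "cmod u < 1" for u
    using that z w ker_ge_1[of "cmod z"] by (auto simp: norm_mult intro!: mult_mono nkernel_bounded)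
qed

lemma integral_nkernel_nkernel:
  assumes z: "cmod z < 1" and w: "cmod w < 1"
  shows "(\<integral>u. nkernel z u * cnj (nkernel w u) \<partial>\<mu>)
    = ker (w * cnj z) / of_real (sqrt (ker ((cmod z)\<^sup>2) * ker ((cmod w)\<^sup>2)))"
proof -
  have "(\<integral>u. nkernel z u * cnj (nkernel w u) \<partial>\<mu>)
     = (\<integral>u. (ker (u * cnj z) * cnj (ker (u * cnj w))) / of_real (sqrt (ker ((cmod z)\<^sup>2) * ker ((cmod w)\<^sup>2))) \<partial>\<mu>)"
    by (simp add: nkernel_def real_sqrt_mult)
  then show ?thesis by (simp add: integral_kernel_kernel[OF z w])
qed

lemma integral_nkernel_square:
  assumes z: "cmod z < 1"
  shows "integrable \<mu> (\<lambda>u. (cmod (nkernel z u))\<^sup>2)" "(\<integral>u. (cmod (nkernel z u))\<^sup>2 \<partial>\<mu>) = 1"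
proof -
  show "integrable \<mu> (\<lambda>u. (cmod (nkernel z u))\<^sup>2)"
    using integrable_nkernel_square_mult[of "\<lambda>_. 1::real", OF _ z] by simp
  have "complex_of_real (\<integral>u. (cmod (nkernel z u))\<^sup>2 \<partial>\<mu>) = (\<integral>u. nkernel z u * cnj (nkernel z u) \<partial>\<mu>)"
    by (subst integral_complex_of_real[symmetric])
       (simp only: complex_norm_square[symmetric] of_real_power)
  also have "\<dots> = ker (of_real ((cmod z)\<^sup>2)) / of_real (ker ((cmod z)\<^sup>2))"
    using ker_square_ge_1[OF z] unfolding integral_nkernel_nkernel[OF z z] complex_norm_square
    by simp
  also have "\<dots> = 1"
    using ker_square_ge_1[OF z] z by (subst ker_of_real) (auto simp: power_less_one_iff)
  finally show "(\<integral>u. (cmod (nkernel z u))\<^sup>2 \<partial>\<mu>) = 1" by (metis of_real_eq_1_iff)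
qed

text \<open>The modulus of the inner product of \<open>k\<^sub>z\<close> and
  \<open>k\<^sub>w\<close>.\<close>

definition overlap :: "complex \<Rightarrow> complex \<Rightarrow> real" where
  "overlap z w = cmod (ker (w * cnj z)) / sqrt (ker ((cmod z)\<^sup>2) * ker ((cmod w)\<^sup>2))"

text \<open>The unimodular factor aligns the phases of the two normalised kernels, which makes
  their distance smallest.\<close>

lemma integral_nkernel_diff:
  assumes z: "cmod z < 1" and w: "cmod w < 1"
  obtains \<theta> where "cmod \<theta> = 1"
    "integrable \<mu> (\<lambda>u. (cmod (nkernel z u - \<theta> * nkernel w u))\<^sup>2)"
    "(\<integral>u. (cmod (nkernel z u - \<theta> * nkernel w u))\<^sup>2 \<partial>\<mu>) = 2 - 2 * overlap z w"
proof -
  define I where "I = (\<integral>u. nkernel z u * cnj (nkernel w u) \<partial>\<mu>)"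
  \<comment> \<open>The phase makes \<open>cnj \<theta> * I\<close> real and nonnegative. If
    \<open>I = 0\<close> any phase will do, but \<open>sgn 0 = 0\<close> is not unimodular.\<close>
  define \<theta> where "\<theta> = (if I = 0 then 1 else sgn I)"
  have \<theta>: "cmod \<theta> = 1" by (simp add: \<theta>_def norm_sgn)
  have "cnj \<theta> * I = of_real (cmod I)"
    by (simp add: \<theta>_def sgn_div_norm scaleR_conv_of_real field_simps power2_eq_square complex_norm_square[symmetric])
  then have Re: "Re (cnj \<theta> * I) = cmod I" by simp
  have ov: "overlap z w = cmod I"
    using ker_square_ge_1[OF z] ker_square_ge_1[OF w]
    by (simp add: overlap_def I_def integral_nkernel_nkernel z w norm_divide)
  have eq: "(cmod (nkernel z u - \<theta> * nkernel w u))\<^sup>2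
      = (cmod (nkernel z u))\<^sup>2 + (cmod (nkernel w u))\<^sup>2 - 2 * Re (cnj \<theta> * (nkernel z u * cnj (nkernel w u)))" for u
  proof -
    have "(cmod (a - \<theta> * b))\<^sup>2 = (cmod a)\<^sup>2 + (cmod (\<theta> * b))\<^sup>2 - 2 * Re (cnj \<theta> * (a * cnj b))" for a b
      unfolding cmod_power2 by (simp add: algebra_simps power2_eq_square)
    then show ?thesis by (simp add: norm_mult \<theta>)
  qed
  have int: "integrable \<mu> (\<lambda>u. Re (cnj \<theta> * (nkernel z u * cnj (nkernel w u))))"
    by (intro integrable_Re integrable_mult_right integrable_nkernel_nkernel z w)
  have val: "(\<integral>u. Re (cnj \<theta> * (nkernel z u * cnj (nkernel w u))) \<partial>\<mu>) = cmod I"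
    using integrable_nkernel_nkernel[OF z w] Re
    by (subst integral_Re) (auto simp: I_def[symmetric] simp del: times_complex.sel)
  show ?thesis
  proof
    show "cmod \<theta> = 1" by fact
    show "integrable \<mu> (\<lambda>u. (cmod (nkernel z u - \<theta> * nkernel w u))\<^sup>2)"
      unfolding eq
      by (intro Bochner_Integration.integrable_diff Bochner_Integration.integrable_add
            integrable_mult_right int integral_nkernel_square z w)
    show "(\<integral>u. (cmod (nkernel z u - \<theta> * nkernel w u))\<^sup>2 \<partial>\<mu>) = 2 - 2 * overlap z w"
      unfolding eq using int integral_nkernel_square[OF z] integral_nkernel_square[OF w] val
      by (simp add: ov del: times_complex.sel)
  qed
qed

section \<open>Mean oscillation as a variance\<close>

lemma L2D:
  assumes "f \<in> L2 \<alpha> \<beta>"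
  shows "f \<in> borel_measurable \<mu>" "integrable \<mu> (\<lambda>u. (cmod (f u))\<^sup>2)" "integrable \<mu> f"
proof -
  show f [measurable]: "f \<in> borel_measurable \<mu>" and f2: "integrable \<mu> (\<lambda>u. (cmod (f u))\<^sup>2)"
    using assms by (auto simp: L2_def)
  have "integrable \<mu> (\<lambda>u. 1 + (cmod (f u))\<^sup>2)" using f2 by auto
  then show "integrable \<mu> f"
  proof (rule Bochner_Integration.integrable_bound[OF _ f], intro AE_I2)
    fix u
    \<comment> \<open>On a finite measure space this bound places \<open>L\<^sup>2\<close> inside
      \<open>L\<^sup>1\<close>.\<close>
    have "cmod (f u) \<le> 1 + (cmod (f u))\<^sup>2"
      using sum_squares_bound[of 1 "cmod (f u)"] norm_ge_zero[of "f u"]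
      unfolding one_power2 mult_1_right by linarith
    then show "cmod (f u) \<le> norm (1 + (cmod (f u))\<^sup>2)" by simp
  qed
qed

text \<open>For the probability measure \<open>\<bar>k\<^sub>z\<bar>\<^sup>2 d\<mu>\<close> this is
  the decomposition of the mean square deviation from \<open>c\<close> into the variance of
  \<open>f\<close> and the squared distance of its mean from \<open>c\<close>.\<close>

lemma integral_deviation:
  assumes f: "f \<in> L2 \<alpha> \<beta>" and z: "cmod z < 1"
  shows "integrable \<mu> (\<lambda>u. (cmod (nkernel z u) * cmod (f u - c))\<^sup>2)"
    and "(\<integral>u. (cmod (nkernel z u) * cmod (f u - c))\<^sup>2 \<partial>\<mu>)
      = berezin \<alpha> \<beta> (\<lambda>u. (cmod (f u))\<^sup>2) z - (cmod (berezin \<alpha> \<beta> f z))\<^sup>2 + (cmod (berezin \<alpha> \<beta> f z - c))\<^sup>2"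
proof -
  let ?k = "\<lambda>u. (cmod (nkernel z u))\<^sup>2"
  have eq: "(cmod (nkernel z u) * cmod (f u - c))\<^sup>2
      = ?k u *\<^sub>R (cmod (f u))\<^sup>2 - 2 * Re (cnj c * (?k u *\<^sub>R f u)) + (cmod c)\<^sup>2 * ?k u" for u
  proof -
    have dev: "(cmod (f u - c))\<^sup>2 = (cmod (f u))\<^sup>2 - 2 * Re (cnj c * f u) + (cmod c)\<^sup>2"
      unfolding cmod_power2 by (simp add: algebra_simps power2_eq_square)
    show ?thesis unfolding power_mult_distrib dev by (simp add: algebra_simps)
  qed
  note i1 = integrable_nkernel_square_mult[OF L2D(2)[OF f] z]
  note i2 = integrable_nkernel_square_mult[OF L2D(3)[OF f] z]
  note i3 = integral_nkernel_square[OF z]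
  have i2': "integrable \<mu> (\<lambda>u. Re (cnj c * (?k u *\<^sub>R f u)))"
    by (intro integrable_Re integrable_mult_right i2)
  have v2: "(\<integral>u. Re (cnj c * (?k u *\<^sub>R f u)) \<partial>\<mu>) = Re (cnj c * berezin \<alpha> \<beta> f z)"
    using integral_Re[OF integrable_mult_right[of "cnj c", OF i2]]
    by (simp only: Bochner_Integration.integral_mult_right_zero berezin_eq[OF z])
  show "integrable \<mu> (\<lambda>u. (cmod (nkernel z u) * cmod (f u - c))\<^sup>2)"
    unfolding eq using i1 i2' i3 by auto
  have "(\<integral>u. (cmod (nkernel z u) * cmod (f u - c))\<^sup>2 \<partial>\<mu>)
     = berezin \<alpha> \<beta> (\<lambda>u. (cmod (f u))\<^sup>2) z - 2 * Re (cnj c * berezin \<alpha> \<beta> f z) + (cmod c)\<^sup>2"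
    unfolding eq using i1 i2' i3 v2 by (simp add: berezin_eq[OF z])
  also have "\<dots> = berezin \<alpha> \<beta> (\<lambda>u. (cmod (f u))\<^sup>2) z - (cmod (berezin \<alpha> \<beta> f z))\<^sup>2 + (cmod (berezin \<alpha> \<beta> f z - c))\<^sup>2"
    unfolding cmod_power2 by (simp add: algebra_simps power2_eq_square)
  finally show "(\<integral>u. (cmod (nkernel z u) * cmod (f u - c))\<^sup>2 \<partial>\<mu>)
      = berezin \<alpha> \<beta> (\<lambda>u. (cmod (f u))\<^sup>2) z - (cmod (berezin \<alpha> \<beta> f z))\<^sup>2 + (cmod (berezin \<alpha> \<beta> f z - c))\<^sup>2" .
qed

text \<open>A variance: take \<open>c\<close> to be the mean in
  \<open>integral_deviation\<close>.\<close>

lemma MO_square_nonneg: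
  assumes "f \<in> L2 \<alpha> \<beta>" "cmod z < 1"
  shows "0 \<le> berezin \<alpha> \<beta> (\<lambda>u. (cmod (f u))\<^sup>2) z - (cmod (berezin \<alpha> \<beta> f z))\<^sup>2"
proof -
  have "0 \<le> (\<integral>u. (cmod (nkernel z u) * cmod (f u - berezin \<alpha> \<beta> f z))\<^sup>2 \<partial>\<mu>)" by simp
  then show ?thesis unfolding integral_deviation(2)[OF assms] by simp
qed

lemma BMO_D:
  assumes "f \<in> BMO \<alpha> \<beta>"
  shows "f \<in> L2 \<alpha> \<beta>" "cmod z < 1 \<Longrightarrow> MO \<alpha> \<beta> f z \<le> BMO_norm \<alpha> \<beta> f" "0 \<le> BMO_norm \<alpha> \<beta> f"
proof -
  show f: "f \<in> L2 \<alpha> \<beta>" using assms by (simp add: BMO_def)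
  have le: "MO \<alpha> \<beta> f z \<le> BMO_norm \<alpha> \<beta> f" if "cmod z < 1" for z
    unfolding BMO_norm_def using assms that by (intro cSUP_upper) (auto simp: BMO_def)
  then show "cmod z < 1 \<Longrightarrow> MO \<alpha> \<beta> f z \<le> BMO_norm \<alpha> \<beta> f" .
  have "0 \<le> MO \<alpha> \<beta> f 0" using MO_square_nonneg[OF f, of 0] by (simp add: MO_def)
  with le[of 0] show "0 \<le> BMO_norm \<alpha> \<beta> f" by simp
qed

text \<open>The inequality \<open>\<Delta> \<le> \<delta> (2 M + \<Delta>)\<close> with
  \<open>\<delta> = sqrt (2 - 2 * overlap z w)\<close>. The term \<open>D\<close> on the right can
  be absorbed as soon as \<open>\<delta> < 1\<close>.\<close>

lemma berezin_diff_le: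
  assumes f: "f \<in> BMO \<alpha> \<beta>" and z: "cmod z < 1" and w: "cmod w < 1"
  defines "D \<equiv> cmod (berezin \<alpha> \<beta> f z - berezin \<alpha> \<beta> f w)"
  shows "D \<le> sqrt (2 - 2 * overlap z w) * (2 * BMO_norm \<alpha> \<beta> f + D)"
proof -
  note fL = BMO_D(1)[OF f]
  \<comment> \<open>Centred at the mean for \<open>z\<close>, the deviation under
    \<open>k\<^sub>z\<close> is exactly \<open>MO\<close> at \<open>z\<close>; under
    \<open>k\<^sub>w\<close> it exceeds \<open>MO\<close> at \<open>w\<close> by at most
    \<open>D\<close>.\<close>
  define c where "c = berezin \<alpha> \<beta> f z"
  let ?X = "nkernel z" and ?Y = "nkernel w"
  obtain \<theta> where \<theta>: "cmod \<theta> = 1"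
    "integrable \<mu> (\<lambda>u. (cmod (?X u - \<theta> * ?Y u))\<^sup>2)"
    "(\<integral>u. (cmod (?X u - \<theta> * ?Y u))\<^sup>2 \<partial>\<mu>) = 2 - 2 * overlap z w"
    using integral_nkernel_diff[OF z w] .
  have [measurable]: "?X \<in> borel_measurable \<mu>" "?Y \<in> borel_measurable \<mu>" "f \<in> borel_measurable \<mu>"
    using nkernel_measurable z w L2D(1)[OF fL] by auto
  note dX = integral_deviation[OF fL z, of c] and dY = integral_deviation[OF fL w, of c]
  note csX = Cauchy_Schwarz_integral[OF _ _ \<theta>(2) dX(1)]
  note csY = Cauchy_Schwarz_integral[OF _ _ \<theta>(2) dY(1)]
  let ?M = "BMO_norm \<alpha> \<beta> f"
  have X: "sqrt (\<integral>u. (cmod (?X u) * cmod (f u - c))\<^sup>2 \<partial>\<mu>) \<le> ?M"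
    unfolding dX(2) using BMO_D(2)[OF f z] by (simp add: MO_def c_def)
  have Y: "sqrt (\<integral>u. (cmod (?Y u) * cmod (f u - c))\<^sup>2 \<partial>\<mu>) \<le> ?M + D"
  proof -
    have "sqrt (\<integral>u. (cmod (?Y u) * cmod (f u - c))\<^sup>2 \<partial>\<mu>) \<le>
      sqrt (berezin \<alpha> \<beta> (\<lambda>u. (cmod (f u))\<^sup>2) w - (cmod (berezin \<alpha> \<beta> f w))\<^sup>2) + sqrt ((cmod (berezin \<alpha> \<beta> f w - c))\<^sup>2)"
      unfolding dY(2) using MO_square_nonneg[OF fL w] by (intro sqrt_add_le_add_sqrt) auto
    then show ?thesis using BMO_D(2)[OF f w] by (simp add: MO_def D_def c_def norm_minus_commute)
  qed
  have int: "integrable \<mu> (\<lambda>u. (cmod (nkernel y u))\<^sup>2 *\<^sub>R (f u - c))"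
    "(\<integral>u. (cmod (nkernel y u))\<^sup>2 *\<^sub>R (f u - c) \<partial>\<mu>) = berezin \<alpha> \<beta> f y - c" if y: "cmod y < 1" for y
  proof -
    note i = integrable_nkernel_square_mult[OF L2D(3)[OF fL] y]
      integrable_nkernel_square_mult[of "\<lambda>_. c", OF _ y]
    show "integrable \<mu> (\<lambda>u. (cmod (nkernel y u))\<^sup>2 *\<^sub>R (f u - c))"
      using i by (simp add: scaleR_diff_right)
    show "(\<integral>u. (cmod (nkernel y u))\<^sup>2 *\<^sub>R (f u - c) \<partial>\<mu>) = berezin \<alpha> \<beta> f y - c"
      using i integral_nkernel_square[OF y] by (simp add: scaleR_diff_right berezin_eq[OF y])
  qed
  have "berezin \<alpha> \<beta> f z - berezin \<alpha> \<beta> f w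
      = (\<integral>u. (cmod (?X u))\<^sup>2 *\<^sub>R (f u - c) - (cmod (?Y u))\<^sup>2 *\<^sub>R (f u - c) \<partial>\<mu>)"
    using int[OF z] int[OF w] by simp
  then have "D = cmod (\<integral>u. (cmod (?X u))\<^sup>2 *\<^sub>R (f u - c) - (cmod (?Y u))\<^sup>2 *\<^sub>R (f u - c) \<partial>\<mu>)"
    by (simp add: D_def)
  also have "\<dots> \<le> (\<integral>u. cmod (?X u - \<theta> * ?Y u) * (cmod (?X u) * cmod (f u - c))
       + cmod (?X u - \<theta> * ?Y u) * (cmod (?Y u) * cmod (f u - c)) \<partial>\<mu>)"
  proof (rule Bochner_Integration.integral_norm_bound_integral)
    show "integrable \<mu> (\<lambda>u. (cmod (?X u))\<^sup>2 *\<^sub>R (f u - c) - (cmod (?Y u))\<^sup>2 *\<^sub>R (f u - c))"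
      using int z w by simp
    show "integrable \<mu> (\<lambda>u. cmod (?X u - \<theta> * ?Y u) * (cmod (?X u) * cmod (f u - c))
       + cmod (?X u - \<theta> * ?Y u) * (cmod (?Y u) * cmod (f u - c)))"
      by (intro Bochner_Integration.integrable_add csX csY) measurable
    fix u
    have "cmod ((cmod (?X u))\<^sup>2 *\<^sub>R (f u - c) - (cmod (?Y u))\<^sup>2 *\<^sub>R (f u - c))
       = \<bar>cmod (?X u) - cmod (\<theta> * ?Y u)\<bar> * ((cmod (?X u) + cmod (?Y u)) * cmod (f u - c))"
    proof -
      \<comment> \<open>Factoring the difference of squares leaves one small factor, and the
        unimodular \<open>\<theta>\<close> can be inserted without changing any modulus.\<close>
      have "(cmod (?X u))\<^sup>2 - (cmod (?Y u))\<^sup>2 = (cmod (?X u) - cmod (\<theta> * ?Y u)) * (cmod (?X u) + cmod (?Y u))"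
        by (simp add: norm_mult \<theta> power2_eq_square algebra_simps)
      then show ?thesis
        by (simp add: scaleR_diff_left[symmetric] abs_mult mult.assoc)
    qed
    also have "\<dots> \<le> cmod (?X u - \<theta> * ?Y u) * ((cmod (?X u) + cmod (?Y u)) * cmod (f u - c))"
      by (intro mult_right_mono norm_triangle_ineq3) auto
    finally show "cmod ((cmod (?X u))\<^sup>2 *\<^sub>R (f u - c) - (cmod (?Y u))\<^sup>2 *\<^sub>R (f u - c))
       \<le> cmod (?X u - \<theta> * ?Y u) * (cmod (?X u) * cmod (f u - c))
       + cmod (?X u - \<theta> * ?Y u) * (cmod (?Y u) * cmod (f u - c))"
      by (simp add: algebra_simps)
  qed
  also have "\<dots> = (\<integral>u. cmod (?X u - \<theta> * ?Y u) * (cmod (?X u) * cmod (f u - c)) \<partial>\<mu>)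
       + (\<integral>u. cmod (?X u - \<theta> * ?Y u) * (cmod (?Y u) * cmod (f u - c)) \<partial>\<mu>)"
    by (intro Bochner_Integration.integral_add csX csY) measurable
  also have "\<dots> \<le> sqrt (2 - 2 * overlap z w) * sqrt (\<integral>u. (cmod (?X u) * cmod (f u - c))\<^sup>2 \<partial>\<mu>)
     + sqrt (2 - 2 * overlap z w) * sqrt (\<integral>u. (cmod (?Y u) * cmod (f u - c))\<^sup>2 \<partial>\<mu>)"
    by (intro add_mono abs_le_D1[OF csX(2), unfolded \<theta>(3)] abs_le_D1[OF csY(2), unfolded \<theta>(3)]) measurable
  also have "\<dots> \<le> sqrt (2 - 2 * overlap z w) * ?M + sqrt (2 - 2 * overlap z w) * (?M + D)"
  proof -
    have "0 \<le> 2 - 2 * overlap z w" unfolding \<theta>(3)[symmetric] by simp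
    then show ?thesis by (intro add_mono mult_left_mono X Y) auto
  qed
  finally show ?thesis by (simp add: algebra_simps)
qed

end

section \<open>The distance of normalised kernels\<close>

text \<open>The difference quotient of the \<open>n\<close>-th power between \<open>z\<close> and
  \<open>w\<close>, written as a polynomial so that it includes the derivative at
  \<open>w = z\<close>.\<close>

definition power_dq :: "nat \<Rightarrow> complex \<Rightarrow> complex \<Rightarrow> complex" where
  "power_dq n z w = (\<Sum>i<n. z ^ (n - Suc i) * w ^ i)"

lemma power_eq_power_dq: "w ^ n = z ^ n + (w - z) * power_dq n z w"
  using power_diff_sumr2[of w n z] by (simp add: power_dq_def algebra_simps)

lemma power_dq_diag: "power_dq n z z = of_nat n * z ^ (n - 1)"
proof -
  have "power_dq n z z = (\<Sum>i<n. z ^ (n - 1))"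
    unfolding power_dq_def by (intro sum.cong) (auto simp: power_add[symmetric])
  then show ?thesis by simp
qed

lemma norm_power_dq_le:
  assumes "cmod z \<le> r" "cmod w \<le> r"
  shows "cmod (power_dq n z w) \<le> real n * r ^ (n - 1)"
proof -
  have r: "r \<ge> 0" using assms(1) norm_ge_zero order_trans by blast
  have "cmod (power_dq n z w) \<le> (\<Sum>i<n. r ^ (n - 1))"
    unfolding power_dq_def
  proof (rule sum_norm_le)
    fix i assume "i \<in> {..<n}"
    then have "r ^ (n - 1) = r ^ (n - Suc i) * r ^ i" by (simp add: power_add[symmetric])
    then show "cmod (z ^ (n - Suc i) * w ^ i) \<le> r ^ (n - 1)"
      using assms r by (auto simp: norm_mult norm_power intro!: mult_mono power_mono)
  qed
  then show ?thesis by simp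
qed

lemma continuous_on_power_dq: "continuous_on A (\<lambda>x. power_dq n (fst x) (snd x))"
  unfolding power_dq_def by (intro continuous_intros)

section \<open>The Gram determinant of two kernels\<close>

context weighted_disc
begin

text \<open>
  Substituting \<open>w\<^sup>n = z\<^sup>n + (w - z) power_dq n z w\<close> in the power series, the Gram determinant of the
  kernels at \<open>z\<close> and \<open>w\<close> becomes \<open>\<bar>w - z\<bar>\<^sup>2 (K(\<bar>z\<bar>\<^sup>2) gram_P - \<bar>gram_Q\<bar>\<^sup>2)\<close>.
\<close>

definition gram_P :: "complex \<Rightarrow> complex \<Rightarrow> real" where
  "gram_P z w = (\<Sum>n. coef n * (cmod (power_dq n z w))\<^sup>2)"

definition gram_Q :: "complex \<Rightarrow> complex \<Rightarrow> complex" where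
  "gram_Q z w = (\<Sum>n. of_real (coef n) * (z ^ n * cnj (power_dq n z w)))"

text \<open>A common majorant for the terms of both series when \<open>z\<close> and
  \<open>w\<close> have modulus at most \<open>r\<close>. Dividing by \<open>r\<close> produces the
  exponent \<open>n - 1\<close> of a difference quotient without truncated subtraction.\<close>

definition gram_bound :: "real \<Rightarrow> nat \<Rightarrow> real" where
  "gram_bound r n = (coef n * (real n + 1)\<^sup>2 * r ^ n) / r"

lemma summable_gram_bound: "0 < r \<Longrightarrow> r < 1 \<Longrightarrow> summable (gram_bound r)"
  using summable_coef_square[of r] unfolding gram_bound_def[abs_def] by (intro summable_divide) simp

text \<open>Each difference quotient contributes \<open>n * r ^ (n - 1)\<close>. Since
  \<open>r < 1\<close>, a second factor \<open>r ^ (n - 1)\<close> or \<open>cmod z ^ n\<close> may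
  be replaced by \<open>1\<close>.\<close>

lemma gram_terms_le:
  assumes r: "0 < r" "r < 1" and zw: "cmod z \<le> r" "cmod w \<le> r"
  shows "norm (coef n * (cmod (power_dq n z w))\<^sup>2) \<le> gram_bound r n"
    and "norm (of_real (coef n) * (z ^ n * cnj (power_dq n z w))) \<le> gram_bound r n"
proof -
  have c: "coef n \<ge> 0" using coef_pos[of n] by simp
  have d: "cmod (power_dq n z w) \<le> real n * r ^ (n - 1)" by (rule norm_power_dq_le[OF zw])
  have b: "coef n * ((real n)\<^sup>2 * r ^ (n - 1)) \<le> gram_bound r n"
  proof (cases n)
    case (Suc m)
    have "coef n * ((real n)\<^sup>2 * r ^ (n - 1)) \<le> coef n * ((real n + 1)\<^sup>2 * r ^ (n - 1))"
      using r c by (intro mult_left_mono mult_right_mono power_mono) auto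
    then show ?thesis using r by (simp add: gram_bound_def Suc)
  qed (use r c in \<open>simp add: gram_bound_def\<close>)
  have 1: "(real n * r ^ (n - 1))\<^sup>2 \<le> (real n)\<^sup>2 * r ^ (n - 1)"
    unfolding power_mult_distrib using r
    by (intro mult_left_mono) (auto simp: power2_eq_square intro!: mult_left_le power_le_one)
  have 2: "real n * r ^ (n - 1) \<le> (real n)\<^sup>2 * r ^ (n - 1)"
    using r by (cases n) (auto intro!: mult_right_mono simp: power2_eq_square)
  have "norm (coef n * (cmod (power_dq n z w))\<^sup>2) = coef n * (cmod (power_dq n z w))\<^sup>2"
    using c by simp
  also have "\<dots> \<le> coef n * ((real n)\<^sup>2 * r ^ (n - 1))"
    using power_mono[OF d norm_ge_zero, of 2] 1 c by (intro mult_left_mono) linarith+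
  finally show "norm (coef n * (cmod (power_dq n z w))\<^sup>2) \<le> gram_bound r n" using b by linarith
  have "cmod z ^ n \<le> 1" using zw r by (intro power_le_one) auto
  then have "cmod z ^ n * cmod (power_dq n z w) \<le> 1 * (real n * r ^ (n - 1))"
    using d r by (intro mult_mono) auto
  then have "coef n * (cmod z ^ n * cmod (power_dq n z w)) \<le> coef n * ((real n)\<^sup>2 * r ^ (n - 1))"
    using 2 c by (intro mult_left_mono) linarith+
  then show "norm (of_real (coef n) * (z ^ n * cnj (power_dq n z w))) \<le> gram_bound r n"
    using b c by (simp add: norm_mult norm_power)
qed

lemma obtain_radius:
  assumes "cmod z < 1" "cmod w < 1"
  obtains r where "0 < r" "r < 1" "cmod z < r" "cmod w < r"
proof -
  obtain r where r: "max (cmod z) (cmod w) < r" "r < 1"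
    using dense[of "max (cmod z) (cmod w)" 1] assms by auto
  moreover have "0 < r" using r norm_ge_zero[of z] by linarith
  ultimately show ?thesis using that by simp
qed

lemma gram_sums:
  assumes "cmod z < 1" "cmod w < 1"
  shows "(\<lambda>n. coef n * (cmod (power_dq n z w))\<^sup>2) sums gram_P z w"
    and "(\<lambda>n. of_real (coef n) * (z ^ n * cnj (power_dq n z w))) sums gram_Q z w"
proof -
  obtain r where r: "0 < r" "r < 1" "cmod z < r" "cmod w < r" using obtain_radius[OF assms] .
  show "(\<lambda>n. coef n * (cmod (power_dq n z w))\<^sup>2) sums gram_P z w"
    unfolding gram_P_def
    by (rule summable_sums, rule summable_comparison_test'[OF summable_gram_bound[OF r(1,2)], of 0], rule gram_terms_le(1)[OF r(1,2)])
       (use r in auto)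
  show "(\<lambda>n. of_real (coef n) * (z ^ n * cnj (power_dq n z w))) sums gram_Q z w"
    unfolding gram_Q_def
    by (rule summable_sums, rule summable_comparison_test'[OF summable_gram_bound[OF r(1,2)], of 0], rule gram_terms_le(2)[OF r(1,2)])
       (use r in auto)
qed

lemma open_bidisc: "open (ball (0::complex) r \<times> ball (0::complex) r)"
  by (intro open_Times open_ball)

text \<open>Continuity is local, and on each smaller bidisc the Weierstrass M-test gives uniform
  convergence.\<close>

lemma continuous_on_gram:
  "continuous_on (ball 0 1 \<times> ball 0 1) (\<lambda>x. gram_P (fst x) (snd x))"
  "continuous_on (ball 0 1 \<times> ball 0 1) (\<lambda>x. gram_Q (fst x) (snd x))"
proof -
  have *: "isCont (\<lambda>x. gram_P (fst x) (snd x)) x \<and> isCont (\<lambda>x. gram_Q (fst x) (snd x)) x"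
    if "x \<in> ball 0 1 \<times> ball 0 1" for x
  proof -
    have x: "cmod (fst x) < 1" "cmod (snd x) < 1" using that by (auto simp: mem_Times_iff)
    obtain r where r: "0 < r" "r < 1" "cmod (fst x) < r" "cmod (snd x) < r"
      using obtain_radius[OF x] .
    let ?A = "ball (0::complex) r \<times> ball (0::complex) r"
    have "continuous_on ?A (\<lambda>x. gram_P (fst x) (snd x))" unfolding gram_P_def
    proof (rule uniform_limit_theorem[OF _ Weierstrass_m_test[OF _ summable_gram_bound[OF r(1,2)]]])
      show "\<forall>\<^sub>F n in sequentially. continuous_on ?A (\<lambda>x. \<Sum>i<n. coef i * (cmod (power_dq i (fst x) (snd x)))\<^sup>2)"
        by (intro always_eventually allI continuous_intros continuous_on_power_dq)
    qed (rule gram_terms_le(1)[OF r(1,2)], auto)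
    moreover have "continuous_on ?A (\<lambda>x. gram_Q (fst x) (snd x))" unfolding gram_Q_def
    proof (rule uniform_limit_theorem[OF _ Weierstrass_m_test[OF _ summable_gram_bound[OF r(1,2)]]])
      show "\<forall>\<^sub>F n in sequentially. continuous_on ?A
          (\<lambda>x. \<Sum>i<n. complex_of_real (coef i) * (fst x ^ i * cnj (power_dq i (fst x) (snd x))))"
        by (intro always_eventually allI continuous_intros continuous_on_power_dq)
    qed (rule gram_terms_le(2)[OF r(1,2)], auto)
    moreover have "x \<in> ?A" using r by (simp add: mem_Times_iff)
    ultimately show ?thesis
      unfolding continuous_on_eq_continuous_at[OF open_bidisc] by (intro conjI) (drule (1) bspec, assumption)+
  qed
  show "continuous_on (ball 0 1 \<times> ball 0 1) (\<lambda>x. gram_P (fst x) (snd x))"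
    "continuous_on (ball 0 1 \<times> ball 0 1) (\<lambda>x. gram_Q (fst x) (snd x))"
    using * by (auto intro!: continuous_at_imp_continuous_on)
qed

lemma norm_sq_less: "cmod z < 1 \<Longrightarrow> \<bar>(cmod z)\<^sup>2\<bar> < 1"
  by (simp add: power_less_one_iff)

text \<open>These are exact identities, obtained coefficient by coefficient from
  \<open>w ^ n = z ^ n + (w - z) * power_dq n z w\<close>. There is no Taylor remainder to
  estimate.\<close>

lemma gram_expansion:
  assumes z: "cmod z < 1" and w: "cmod w < 1"
  shows "ker (z * cnj w) = of_real (ker ((cmod z)\<^sup>2)) + cnj (w - z) * gram_Q z w"
    and "ker ((cmod w)\<^sup>2) = ker ((cmod z)\<^sup>2) + 2 * Re (cnj (w - z) * gram_Q z w)
        + (cmod (w - z))\<^sup>2 * gram_P z w"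
proof -
  have Gz: "(\<lambda>n. coef n * ((cmod z)\<^sup>2) ^ n) sums ker ((cmod z)\<^sup>2)"
    and Gw: "(\<lambda>n. coef n * ((cmod w)\<^sup>2) ^ n) sums ker ((cmod w)\<^sup>2)"
    using ker_sums[of "(cmod z)\<^sup>2"] ker_sums[of "(cmod w)\<^sup>2"] norm_sq_less z w by simp_all
  note Q = sums_mult[OF gram_sums(2)[OF z w], of "cnj (w - z)"]
  have "(\<lambda>n. complex_of_real (coef n * ((cmod z)\<^sup>2) ^ n) + cnj (w - z) * (of_real (coef n) * (z ^ n * cnj (power_dq n z w))))
      sums (of_real (ker ((cmod z)\<^sup>2)) + cnj (w - z) * gram_Q z w)"
    by (intro sums_add Q sums_of_real Gz)
  moreover have "complex_of_real (coef n * ((cmod z)\<^sup>2) ^ n) + cnj (w - z) * (of_real (coef n) * (z ^ n * cnj (power_dq n z w)))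
      = of_real (coef n) * (z * cnj w) ^ n" for n
  proof -
    have "cnj w ^ n = cnj z ^ n + cnj (w - z) * cnj (power_dq n z w)"
      by (subst complex_cnj_power[symmetric], subst power_eq_power_dq[of w n z]) simp
    moreover have "complex_of_real (((cmod z)\<^sup>2) ^ n) = z ^ n * cnj z ^ n"
      by (metis complex_norm_square of_real_power power_mult_distrib)
    ultimately show ?thesis
      unfolding of_real_mult power_mult_distrib by (simp only: ring_distribs mult_ac)
  qed
  ultimately show "ker (z * cnj w) = of_real (ker ((cmod z)\<^sup>2)) + cnj (w - z) * gram_Q z w"
    using ker_sums[OF kernel_norm_less[OF z w]] sums_unique2 by force
  have "(\<lambda>n. coef n * ((cmod z)\<^sup>2) ^ n + 2 * Re (cnj (w - z) * (of_real (coef n) * (z ^ n * cnj (power_dq n z w))))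
       + (cmod (w - z))\<^sup>2 * (coef n * (cmod (power_dq n z w))\<^sup>2))
     sums (ker ((cmod z)\<^sup>2) + 2 * Re (cnj (w - z) * gram_Q z w) + (cmod (w - z))\<^sup>2 * gram_P z w)"
    by (intro sums_add Gz sums_mult sums_Re[OF Q] gram_sums(1) z w)
  moreover have "coef n * ((cmod z)\<^sup>2) ^ n + 2 * Re (cnj (w - z) * (of_real (coef n) * (z ^ n * cnj (power_dq n z w))))
       + (cmod (w - z))\<^sup>2 * (coef n * (cmod (power_dq n z w))\<^sup>2) = coef n * ((cmod w)\<^sup>2) ^ n" for n
  proof -
    have "(cmod (a + h * d))\<^sup>2 = (cmod a)\<^sup>2 + 2 * Re (cnj h * (a * cnj d)) + (cmod h)\<^sup>2 * (cmod d)\<^sup>2" for a h d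
      unfolding cmod_power2 by (simp add: algebra_simps power2_eq_square)
    from this[of "z ^ n" "w - z" "power_dq n z w"]
    have "((cmod w)\<^sup>2) ^ n = ((cmod z)\<^sup>2) ^ n + 2 * Re (cnj (w - z) * (z ^ n * cnj (power_dq n z w)))
        + (cmod (w - z))\<^sup>2 * (cmod (power_dq n z w))\<^sup>2"
      unfolding power_eq_power_dq[of w n z, symmetric] norm_power by (simp add: power_mult[symmetric] mult.commute)
    moreover have "Re (cnj (w - z) * (of_real (coef n) * (z ^ n * cnj (power_dq n z w))))
        = coef n * Re (cnj (w - z) * (z ^ n * cnj (power_dq n z w)))"
      by (simp only: mult.left_commute[of _ "complex_of_real (coef n)"] Re_complex_of_real times_complex.sel
          Im_complex_of_real mult_zero_left diff_zero)
    ultimately show ?thesis by (simp only: ring_distribs mult_ac)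
  qed
  ultimately show "ker ((cmod w)\<^sup>2) = ker ((cmod z)\<^sup>2) + 2 * Re (cnj (w - z) * gram_Q z w)
        + (cmod (w - z))\<^sup>2 * gram_P z w"
    using Gw sums_unique2 by force
qed

text \<open>The Gram determinant of \<open>k\<^sub>z\<close> and \<open>k\<^sub>w\<close> divided by
  \<open>\<bar>w - z\<bar>\<^sup>2\<close>, in a form that extends to the diagonal.\<close>

definition gram_quotient :: "complex \<Rightarrow> complex \<Rightarrow> real" where
  "gram_quotient z w = (ker ((cmod z)\<^sup>2) * gram_P z w - (cmod (gram_Q z w))\<^sup>2)
      / (ker ((cmod z)\<^sup>2) * ker ((cmod w)\<^sup>2))"

lemma overlap_eq_gram:
  assumes z: "cmod z < 1" and w: "cmod w < 1"
  shows "1 - (overlap z w)\<^sup>2 = (cmod (w - z))\<^sup>2 * gram_quotient z w"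
proof -
  let ?G = "ker ((cmod z)\<^sup>2)" and ?H = "ker ((cmod w)\<^sup>2)" and ?h = "cnj (w - z) * gram_Q z w"
  have pos: "?G > 0" "?H > 0" using ker_square_ge_1 z w by (smt (verit))+
  have "cmod (ker (w * cnj z)) = cmod (ker (z * cnj w))"
    using ker_cnj[OF kernel_norm_less[OF w z]] by (metis complex_cnj_cnj complex_cnj_mult complex_mod_cnj mult.commute)
  then have "(overlap z w)\<^sup>2 = (cmod (of_real ?G + ?h))\<^sup>2 / (?G * ?H)"
    using pos unfolding gram_expansion(1)[OF z w, symmetric] by (simp add: overlap_def power_divide)
  also have "(cmod (of_real ?G + ?h))\<^sup>2 = ?G\<^sup>2 + 2 * ?G * Re ?h + (cmod ?h)\<^sup>2"
    unfolding cmod_power2 by (simp add: algebra_simps power2_eq_square)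
  \<comment> \<open>Both the square and \<open>?G * ?H\<close> contain
    \<open>?G\<^sup>2 + 2 * ?G * Re ?h\<close>; what remains carries the factor
    \<open>(cmod (w - z))\<^sup>2\<close>.\<close>
  also have "\<dots> = ?G * ?H - (cmod (w - z))\<^sup>2 * (?G * gram_P z w - (cmod (gram_Q z w))\<^sup>2)"
    unfolding gram_expansion(2)[OF z w] norm_mult complex_mod_cnj
    by (simp add: algebra_simps power2_eq_square del: times_complex.sel minus_complex.sel)
  finally show ?thesis using pos by (simp add: gram_quotient_def field_simps)
qed

lemma continuous_on_ker_square: "continuous_on (ball 0 1) (\<lambda>z::complex. ker ((cmod z)\<^sup>2))"
  by (intro continuous_on_compose2[OF continuous_on_ker] continuous_intros) (auto simp: power_less_one_iff)

lemma continuous_on_ker_fst_snd: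
  "continuous_on (ball 0 1 \<times> ball 0 1) (\<lambda>x::complex \<times> complex. ker ((cmod (fst x))\<^sup>2))"
  "continuous_on (ball 0 1 \<times> ball 0 1) (\<lambda>x::complex \<times> complex. ker ((cmod (snd x))\<^sup>2))"
  "continuous_on (ball 0 1 \<times> ball 0 1) (\<lambda>x::complex \<times> complex. ker (snd x * cnj (fst x)))"
proof -
  show "continuous_on (ball 0 1 \<times> ball 0 1) (\<lambda>x::complex \<times> complex. ker ((cmod (fst x))\<^sup>2))"
    by (rule continuous_on_compose2[OF continuous_on_ker_square]) (auto intro: continuous_intros)
  show "continuous_on (ball 0 1 \<times> ball 0 1) (\<lambda>x::complex \<times> complex. ker ((cmod (snd x))\<^sup>2))"
    by (rule continuous_on_compose2[OF continuous_on_ker_square]) (auto intro: continuous_intros)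
  show "continuous_on (ball 0 1 \<times> ball 0 1) (\<lambda>x::complex \<times> complex. ker (snd x * cnj (fst x)))"
  proof (rule continuous_on_compose2[OF continuous_on_ker])
    show "continuous_on (ball 0 1 \<times> ball 0 1) (\<lambda>x::complex \<times> complex. snd x * cnj (fst x))"
      by (intro continuous_intros)
  qed (auto intro!: kernel_norm_less)
qed

lemma continuous_on_gram_quotient:
  "continuous_on (ball 0 1 \<times> ball 0 1) (\<lambda>x. gram_quotient (fst x) (snd x))"
  unfolding gram_quotient_def
  by (intro continuous_intros continuous_on_gram continuous_on_ker_fst_snd ballI)
     (auto dest!: ker_square_ge_1)

lemma continuous_on_overlap:
  "continuous_on (ball 0 1 \<times> ball 0 1) (\<lambda>x. overlap (fst x) (snd x))"
  unfolding overlap_def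
  by (intro continuous_intros continuous_on_ker_fst_snd ballI)
     (auto dest!: ker_square_ge_1)

lemma overlap_diag: "cmod z < 1 \<Longrightarrow> overlap z z = 1"
proof -
  assume z: "cmod z < 1"
  have "overlap z z \<ge> 0" using ker_square_ge_1[OF z] by (simp add: overlap_def)
  moreover have "(overlap z z)\<^sup>2 = 1" using overlap_eq_gram[OF z z] by simp
  ultimately show ?thesis by (simp add: power2_eq_1_iff)
qed

lemma overlap_nonneg: "cmod z < 1 \<Longrightarrow> cmod w < 1 \<Longrightarrow> 0 \<le> overlap z w"
  using ker_square_ge_1[of z] ker_square_ge_1[of w] by (simp add: overlap_def)

lemma overlap_le_1: "cmod z < 1 \<Longrightarrow> cmod w < 1 \<Longrightarrow> overlap z w \<le> 1"
proof -
  assume zw: "cmod z < 1" "cmod w < 1"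
  obtain \<theta> where "(\<integral>u. (cmod (nkernel z u - \<theta> * nkernel w u))\<^sup>2 \<partial>\<mu>) = 2 - 2 * overlap z w"
    using integral_nkernel_diff[OF zw] .
  moreover have "0 \<le> (\<integral>u. (cmod (nkernel z u - \<theta> * nkernel w u))\<^sup>2 \<partial>\<mu>)" by simp
  ultimately show "overlap z w \<le> 1" by linarith
qed

text \<open>Off the diagonal the quotient is
  \<open>(1 - overlap\<^sup>2) / \<bar>w - z\<bar>\<^sup>2\<close>, which is nonnegative because
  \<open>overlap \<le> 1\<close>. Continuity carries the sign to the diagonal.\<close>

lemma gram_quotient_diag_nonneg:
  assumes "cmod p < 1"
  shows "0 \<le> gram_quotient p p"
proof (rule ccontr)
  assume neg: "\<not> 0 \<le> gram_quotient p p"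
  have p: "(p, p) \<in> ball 0 1 \<times> ball 0 1" using assms by simp
  have "isCont (\<lambda>x. gram_quotient (fst x) (snd x)) (p, p)"
    using continuous_on_gram_quotient[unfolded continuous_on_eq_continuous_at[OF open_bidisc]] p by (rule bspec)
  then have "((\<lambda>x. gram_quotient (fst x) (snd x)) \<longlongrightarrow> gram_quotient p p) (nhds (p, p))"
    using tendsto_at_iff_tendsto_nhds[of "\<lambda>x. gram_quotient (fst x) (snd x)" "(p, p)"]
    by (simp add: isCont_def)
  then have "\<forall>\<^sub>F x in nhds (p, p). gram_quotient (fst x) (snd x) < 0"
    using neg by (intro order_tendstoD) auto
  moreover have "\<forall>\<^sub>F x in nhds (p, p). x \<in> ball 0 1 \<times> ball 0 1"
    using p open_bidisc by (rule eventually_nhds_in_open[rotated])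
  ultimately have "\<forall>\<^sub>F x in nhds (p, p). gram_quotient (fst x) (snd x) < 0 \<and> x \<in> ball 0 1 \<times> ball 0 1"
    by (rule eventually_conj)
  then obtain d where d: "d > 0"
    "\<And>x. dist x (p, p) < d \<Longrightarrow> gram_quotient (fst x) (snd x) < 0 \<and> x \<in> ball 0 1 \<times> ball 0 1"
    unfolding eventually_nhds_metric by blast
  \<comment> \<open>Any point other than \<open>p\<close> within distance \<open>d\<close> would
    serve.\<close>
  define w where "w = p + of_real (d / 2)"
  have w: "cmod (w - p) = d / 2" using d by (simp add: w_def)
  have "cmod w < 1" "gram_quotient p w < 0"
    using d(2)[of "(p, w)"] d(1) w by (auto simp: dist_Pair_Pair dist_norm)
  moreover have "(overlap p w)\<^sup>2 \<le> 1"
    using overlap_nonneg overlap_le_1 assms \<open>cmod w < 1\<close> by (intro power_le_one) auto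
  then have "0 \<le> (d / 2)\<^sup>2 * gram_quotient p w"
    using overlap_eq_gram[OF assms \<open>cmod w < 1\<close>] unfolding w by linarith
  ultimately show False using d(1) by (simp add: zero_le_mult_iff)
qed

end

section \<open>The metric density\<close>

lemma d_z_eqI:
  assumes "(f has_derivative D) (at z)"
  shows "d_z f z = (D 1 - \<i> * D \<i>) / 2" "d_zbar f z = (D 1 + \<i> * D \<i>) / 2"
  using frechet_derivative_at[OF assms] by (simp_all add: d_z_def d_zbar_def)

lemma has_derivative_cmod_square:
  "((\<lambda>z. (cmod z)\<^sup>2) has_derivative (\<lambda>v. 2 * (z \<bullet> v))) (at z)"
  unfolding power2_norm_eq_inner
  by (auto intro!: derivative_eq_intros simp: inner_commute)

text \<open>The chain rule with \<open>\<bar>z\<bar>\<^sup>2 = z * cnj z\<close>. The two parts fit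
  together: the first, applied to \<open>kappa\<close>, yields a function of the shape treated by
  the second.\<close>

lemma radial_wirtinger:
  assumes "(\<phi> has_real_derivative D) (at ((cmod z)\<^sup>2))"
  shows "d_zbar (\<lambda>w. of_real (\<phi> ((cmod w)\<^sup>2))) z = of_real D * z"
    and "d_z (\<lambda>w. of_real (\<phi> ((cmod w)\<^sup>2)) * w) z = of_real (\<phi> ((cmod z)\<^sup>2) + D * (cmod z)\<^sup>2)"
proof -
  note d = has_derivative_of_real[OF DERIV_compose_FDERIV[OF assms has_derivative_cmod_square], where 'a = complex]
  show "d_zbar (\<lambda>w. of_real (\<phi> ((cmod w)\<^sup>2))) z = of_real D * z"
    unfolding d_z_eqI(2)[OF d] by (simp add: complex_eq_iff inner_complex_def)
  note d2 = has_derivative_mult[OF d has_derivative_ident]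
  show "d_z (\<lambda>w. of_real (\<phi> ((cmod w)\<^sup>2)) * w) z = of_real (\<phi> ((cmod z)\<^sup>2) + D * (cmod z)\<^sup>2)"
    unfolding d_z_eqI(1)[OF d2] of_real_add of_real_mult complex_norm_square
    by (simp add: complex_eq_iff inner_complex_def algebra_simps)
qed

text \<open>Lets the outer Wirtinger derivative of \<open>kappa\<close> use a formula for the inner
  one that is established only inside the disc.\<close>

lemma d_z_cong:
  assumes "open S" "z \<in> S" "\<And>w. w \<in> S \<Longrightarrow> f w = g w"
  shows "d_z f z = d_z g z"
proof -
  have "(f has_derivative D) (at z) \<longleftrightarrow> (g has_derivative D) (at z)" for D
    using assms has_derivative_transform_within_open[of _ D z UNIV S] by metis
  then have "frechet_derivative f (at z) = frechet_derivative g (at z)"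
    by (simp add: frechet_derivative_def)
  then show ?thesis by (simp add: d_z_def)
qed

section \<open>The radial kernel series, its derivatives and the density\<close>

context weighted_disc
begin

definition ker' :: "real \<Rightarrow> real" where
  "ker' x = (\<Sum>n. diffs coef n * x ^ n)"

text \<open>\<open>kerS\<close> is the derivative of \<open>x ker' x\<close>.\<close>

definition kerS :: "real \<Rightarrow> real" where
  "kerS x = (\<Sum>n. coef n * (real n)\<^sup>2 * x ^ (n - 1))"

lemma ker_real: "ker (x::real) = (\<Sum>n. coef n * x ^ n)"
  by (simp add: ker_def')

lemma summable_coef_real: "norm (x::real) < 1 \<Longrightarrow> summable (\<lambda>n. coef n * x ^ n)"
  using summable_ker(2)[of x] by simp

lemma ker_has_derivative:
  assumes "\<bar>x\<bar> < 1"
  shows "(ker has_real_derivative ker' x) (at x)"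
proof -
  have "((\<lambda>x. \<Sum>n. coef n * x ^ n) has_field_derivative (\<Sum>n. diffs coef n * x ^ n)) (at x)"
    by (rule termdiffs_strong'[of 1]) (use assms summable_coef_real in auto)
  then show ?thesis by (simp add: ker_real[abs_def] ker'_def)
qed

lemma ker'_sums:
  assumes "\<bar>x\<bar> < 1"
  shows "(\<lambda>n. real n * coef n * x ^ (n - 1)) sums ker' x"
proof -
  have "summable (\<lambda>n. diffs coef n * x ^ n)"
    by (rule termdiff_converges[of x 1]) (use assms summable_coef_real in auto)
  then show ?thesis using diffs_equiv[of coef x] by (simp add: ker'_def)
qed

lemma mult_ker'_sums:
  assumes "\<bar>x\<bar> < 1"
  shows "(\<lambda>n. (real n * coef n) * x ^ n) sums (x * ker' x)"
proof -
  have "x * (real n * coef n * x ^ (n - 1)) = (real n * coef n) * x ^ n" for n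
    by (cases n) auto
  then show ?thesis using sums_mult[OF ker'_sums[OF assms], of x] by (simp only:)
qed

lemma mult_ker'_has_derivative:
  assumes "\<bar>x\<bar> < 1"
  shows "((\<lambda>x. x * ker' x) has_real_derivative kerS x) (at x)"
    and "(\<lambda>n. coef n * (real n)\<^sup>2 * x ^ (n - 1)) sums kerS x"
proof -
  let ?c = "\<lambda>n. real n * coef n"
  have sm: "summable (\<lambda>n. ?c n * y ^ n)" if "norm y < 1" for y :: real
    using mult_ker'_sums[of y] that by (simp add: sums_iff)
  have d: "((\<lambda>x. \<Sum>n. ?c n * x ^ n) has_field_derivative (\<Sum>n. diffs ?c n * x ^ n)) (at x)"
    by (rule termdiffs_strong'[of 1]) (use assms sm in auto)
  have "summable (\<lambda>n. diffs ?c n * x ^ n)"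
    by (rule termdiff_converges[of x 1]) (use assms sm in auto)
  then have s: "(\<lambda>n. real n * ?c n * x ^ (n - Suc 0)) sums (\<Sum>n. diffs ?c n * x ^ n)"
    using diffs_equiv[of ?c x] by simp
  then have eq: "(\<Sum>n. diffs ?c n * x ^ n) = kerS x"
    by (simp add: sums_iff kerS_def power2_eq_square mult_ac)
  show "(\<lambda>n. coef n * (real n)\<^sup>2 * x ^ (n - 1)) sums kerS x"
    using s unfolding eq by (simp add: power2_eq_square mult_ac)
  show "((\<lambda>x. x * ker' x) has_real_derivative kerS x) (at x)"
  proof (rule has_field_derivative_transform_within_open[OF d[unfolded eq], of "{-1<..<1}"])
    fix y :: real assume "y \<in> {-1<..<1}"
    then have "\<bar>y\<bar> < 1" by auto
    from mult_ker'_sums[OF this] show "(\<Sum>n. ?c n * y ^ n) = y * ker' y" by (simp add: sums_iff)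
  qed (use assms in auto)
qed

text \<open>Existence suffices: the value of the second derivative is later expressed through
  \<open>kerS\<close>.\<close>

lemma ker'_differentiable:
  assumes "\<bar>x\<bar> < 1"
  obtains D where "(ker' has_real_derivative D) (at x)"
proof -
  have "((\<lambda>x. \<Sum>n. diffs coef n * x ^ n) has_field_derivative (\<Sum>n. diffs (diffs coef) n * x ^ n)) (at x)"
    by (rule termdiffs_strong'[of 1])
       (use assms in \<open>auto intro!: termdiff_converges[of _ 1] summable_coef_real\<close>)
  then show ?thesis using that by (simp add: ker'_def[abs_def])
qed

text \<open>On the diagonal the difference quotients become \<open>n * p ^ (n - 1)\<close>, which
  identifies both Gram series with termwise derivatives of \<open>ker\<close>.\<close>

lemma gram_diag:
  assumes "cmod p < 1"
  shows "gram_P p p = kerS ((cmod p)\<^sup>2)" "gram_Q p p = p * of_real (ker' ((cmod p)\<^sup>2))"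
proof -
  have r: "\<bar>(cmod p)\<^sup>2\<bar> < 1" using norm_sq_less[OF assms] .
  have "coef n * (cmod (power_dq n p p))\<^sup>2 = coef n * (real n)\<^sup>2 * ((cmod p)\<^sup>2) ^ (n - 1)" for n
    by (simp add: power_dq_diag norm_mult norm_power power_mult_distrib power_mult[symmetric] mult.commute[of 2])
  then show "gram_P p p = kerS ((cmod p)\<^sup>2)"
    using gram_sums(1)[OF assms assms] mult_ker'_has_derivative(2)[OF r]
    by (simp only: sums_unique2)
  have "p * of_real (real n * coef n * ((cmod p)\<^sup>2) ^ (n - 1)) = of_real (coef n) * (p ^ n * cnj (power_dq n p p))" for n
  proof (cases n)
    case (Suc m)
    have "complex_of_real (((cmod p)\<^sup>2) ^ m) = p ^ m * cnj p ^ m"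
      by (metis complex_norm_square of_real_power power_mult_distrib)
    then show ?thesis by (simp add: Suc power_dq_diag algebra_simps)
  qed (simp add: power_dq_diag)
  moreover have "(\<lambda>n. p * of_real (real n * coef n * ((cmod p)\<^sup>2) ^ (n - 1))) sums (p * of_real (ker' ((cmod p)\<^sup>2)))"
    by (intro sums_mult sums_of_real ker'_sums r)
  ultimately show "gram_Q p p = p * of_real (ker' ((cmod p)\<^sup>2))"
    using gram_sums(2)[OF assms assms] by (simp only: sums_unique2)
qed

text \<open>With \<open>F = ker\<close> and \<open>g = F' / F\<close>, the Wirtinger derivatives of
  \<open>ln F(\<bar>z\<bar>\<^sup>2)\<close> give \<open>g + r g'\<close> at
  \<open>r = \<bar>p\<bar>\<^sup>2\<close>. This equals
  \<open>(F (r F')' - r F'\<^sup>2) / F\<^sup>2\<close>, the Gram quotient on the diagonal.\<close>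

lemma rho_eq:
  assumes p: "cmod p < 1"
  shows "rho \<alpha> \<beta> p = sqrt (gram_quotient p p)"
proof -
  define g where "g x = ker' x / ker x" for x
  define r where "r = (cmod p)\<^sup>2"
  have r: "\<bar>r\<bar> < 1" using norm_sq_less[OF p] by (simp add: r_def)
  have pos: "ker ((cmod z)\<^sup>2) > 0" if "cmod z < 1" for z :: complex
    using ker_square_ge_1[OF that] by linarith
  have kr: "ker r > 0" using pos[OF p] by (simp add: r_def)
  have ln: "((\<lambda>x. ln (ker x)) has_real_derivative g ((cmod z)\<^sup>2)) (at ((cmod z)\<^sup>2))" if "cmod z < 1" for z :: complex
    using ker_has_derivative[OF norm_sq_less[OF that]] pos[OF that]
    by (auto intro!: derivative_eq_intros simp: g_def)
  have zbar: "d_zbar (\<lambda>w. complex_of_real (kappa \<alpha> \<beta> w)) z = of_real (g ((cmod z)\<^sup>2)) * z" if "z \<in> ball 0 1" for z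
    using radial_wirtinger(1)[OF ln[of z]] that by (simp add: kappa_def)
  obtain E where E: "(ker' has_real_derivative E) (at r)" using ker'_differentiable[OF r] .
  have "((\<lambda>x. x * ker' x) has_real_derivative ker' r + r * E) (at r)"
    using E by (auto intro!: derivative_eq_intros)
  \<comment> \<open>Uniqueness of the derivative of \<open>x * ker' x\<close> allows
    \<open>E\<close> to be eliminated in favour of \<open>kerS\<close>.\<close>
  then have S: "kerS r = ker' r + r * E"
    using mult_ker'_has_derivative(1)[OF r] DERIV_unique by blast
  have g': "(g has_real_derivative (E * ker r - ker' r * ker' r) / (ker r * ker r)) (at r)"
    unfolding g_def[abs_def] using E ker_has_derivative[OF r] kr
    by (auto intro!: derivative_eq_intros)
  have "d_z (d_zbar (\<lambda>w. complex_of_real (kappa \<alpha> \<beta> w))) p = d_z (\<lambda>w. of_real (g ((cmod w)\<^sup>2)) * w) p"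
    by (rule d_z_cong[of "ball 0 1"]) (use p zbar in auto)
  also have "\<dots> = of_real (g r + (E * ker r - ker' r * ker' r) / (ker r * ker r) * r)"
    using radial_wirtinger(2)[OF g'[unfolded r_def]] by (simp add: r_def)
  finally have "rho \<alpha> \<beta> p = sqrt (g r + (E * ker r - ker' r * ker' r) / (ker r * ker r) * r)"
    unfolding rho_def by (simp only: Re_complex_of_real)
  also have "g r + (E * ker r - ker' r * ker' r) / (ker r * ker r) * r = (ker r * kerS r - r * (ker' r)\<^sup>2) / (ker r * ker r)"
    using kr by (simp add: g_def S field_simps power2_eq_square)
  also have "\<dots> = gram_quotient p p"
    using p by (simp add: gram_quotient_def gram_diag norm_mult power_mult_distrib r_def)
  finally show ?thesis .
qed

lemma rho_nonneg: "cmod p < 1 \<Longrightarrow> 0 \<le> rho \<alpha> \<beta> p"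
  by (simp add: rho_eq gram_quotient_diag_nonneg)

lemma continuous_on_rho: "continuous_on (ball 0 1) (rho \<alpha> \<beta>)"
proof -
  have "continuous_on (ball 0 1) (\<lambda>p. sqrt (gram_quotient p p))"
    using continuous_on_compose2[OF continuous_on_gram_quotient, of "ball 0 1" "\<lambda>p. (p, p)"]
    by (intro continuous_intros) (simp add: continuous_on_Pair image_subset_iff)
  then show ?thesis by (rule continuous_on_eq) (simp add: rho_eq)
qed

text \<open>For \<open>\<delta> < 1\<close> the inequality of \<open>berezin_diff_le\<close> can be
  solved for the difference, giving \<open>2 M \<delta> / (1 - \<delta>)\<close>. Near
  \<open>p\<close> this is \<open>\<bar>w - z\<bar>\<close> times a factor close to
  \<open>2 M \<rho>(p)\<close>.\<close>

lemma berezin_locally_Lipschitz: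
  assumes f: "f \<in> BMO \<alpha> \<beta>" and p: "cmod p < 1" and "\<epsilon> > 0"
  obtains d where "d > 0" "\<And>z w. dist z p < d \<Longrightarrow> dist w p < d \<Longrightarrow> cmod z < 1 \<and> cmod w < 1 \<and>
     cmod (berezin \<alpha> \<beta> f z - berezin \<alpha> \<beta> f w) \<le> 2 * BMO_norm \<alpha> \<beta> f * (rho \<alpha> \<beta> p + \<epsilon>) * cmod (w - z)"
proof -
  let ?U = "ball (0::complex) 1 \<times> ball (0::complex) 1"
  \<comment> \<open>From \<open>2 - 2 t = 2 (1 - t\<^sup>2) / (1 + t)\<close> with \<open>t\<close>
    the overlap: \<open>\<Theta>\<close> is the kernel distance divided by
    \<open>\<bar>w - z\<bar>\<close>, extended continuously to the diagonal, where
    \<open>t = 1\<close> and its value is \<open>rho\<close>.\<close>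
  define \<Theta> where "\<Theta> x = sqrt (2 * gram_quotient (fst x) (snd x) / (1 + overlap (fst x) (snd x)))" for x
  define \<delta> where "\<delta> x = cmod (snd x - fst x) * \<Theta> x" for x
  have nz: "1 + overlap (fst x) (snd x) > 0" if "x \<in> ?U" for x
    using overlap_nonneg[of "fst x" "snd x"] that by (auto simp: mem_Times_iff)
  have cont\<Theta>: "continuous_on ?U \<Theta>"
    unfolding \<Theta>_def using nz
    by (intro continuous_intros continuous_on_gram_quotient continuous_on_overlap) (auto simp: less_imp_neq[symmetric])
  have cont\<delta>: "continuous_on ?U \<delta>"
    unfolding \<delta>_def by (intro continuous_intros cont\<Theta>)
  have pU: "(p, p) \<in> ?U" using p by simp
  have \<Theta>p: "\<Theta> (p, p) = rho \<alpha> \<beta> p" using p by (simp add: \<Theta>_def overlap_diag rho_eq)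
  have \<delta>p: "\<delta> (p, p) = 0" by (simp add: \<delta>_def)
  have tend: "(h \<longlongrightarrow> h (p, p)) (nhds (p, p))" if "continuous_on ?U h" for h :: "complex \<times> complex \<Rightarrow> real"
    using that pU continuous_on_eq_continuous_at[OF open_bidisc, of 1 h]
    by (auto simp: isCont_def tendsto_at_iff_tendsto_nhds)
  have "((\<lambda>x. \<Theta> x / (1 - \<delta> x)) \<longlongrightarrow> rho \<alpha> \<beta> p / (1 - 0)) (nhds (p, p))"
    using tend[OF cont\<Theta>] tend[OF cont\<delta>] unfolding \<Theta>p \<delta>p by (intro tendsto_intros) auto
  then have "\<forall>\<^sub>F x in nhds (p, p). \<Theta> x / (1 - \<delta> x) < rho \<alpha> \<beta> p + \<epsilon>"
    using \<open>\<epsilon> > 0\<close> by (intro order_tendstoD) auto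
  moreover have "\<forall>\<^sub>F x in nhds (p, p). \<delta> x < 1"
    using tend[OF cont\<delta>] unfolding \<delta>p by (intro order_tendstoD) auto
  moreover have "\<forall>\<^sub>F x in nhds (p, p). x \<in> ?U"
    using pU open_bidisc by (rule eventually_nhds_in_open[rotated])
  ultimately have "\<forall>\<^sub>F x in nhds (p, p). \<Theta> x / (1 - \<delta> x) < rho \<alpha> \<beta> p + \<epsilon> \<and> \<delta> x < 1 \<and> x \<in> ?U"
    by eventually_elim simp
  then obtain d where d: "d > 0" "\<And>x. dist x (p, p) < d \<Longrightarrow>
      \<Theta> x / (1 - \<delta> x) < rho \<alpha> \<beta> p + \<epsilon> \<and> \<delta> x < 1 \<and> x \<in> ?U"
    unfolding eventually_nhds_metric by blast
  show ?thesis
  \<comment> \<open>Two points within \<open>d / 2\<close> of \<open>p\<close> form a pair within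
    \<open>d\<close> of \<open>(p, p)\<close>.\<close>
  proof (rule that[of "d / 2"])
    show "d / 2 > 0" using d by simp
    fix z w assume zw: "dist z p < d / 2" "dist w p < d / 2"
    have "dist (z, w) (p, p) \<le> dist z p + dist w p"
      unfolding dist_Pair_Pair using sqrt_sum_squares_le_sum_abs[of "dist z p" "dist w p"] by simp
    then have "dist (z, w) (p, p) < d" using zw by linarith
    from d(2)[OF this] have x: "\<Theta> (z, w) / (1 - \<delta> (z, w)) < rho \<alpha> \<beta> p + \<epsilon>" "\<delta> (z, w) < 1"
      and z: "cmod z < 1" and w: "cmod w < 1" by auto
    define D where "D = cmod (berezin \<alpha> \<beta> f z - berezin \<alpha> \<beta> f w)"
    define M where "M = BMO_norm \<alpha> \<beta> f"
    have M: "M \<ge> 0" using BMO_D(3)[OF f] by (simp add: M_def)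
    have "2 - 2 * overlap z w = 2 * (1 - (overlap z w)\<^sup>2) / (1 + overlap z w)"
      using overlap_nonneg[OF z w] by (simp add: field_simps power2_eq_square)
    also have "\<dots> = (cmod (w - z))\<^sup>2 * (2 * gram_quotient z w / (1 + overlap z w))"
      unfolding overlap_eq_gram[OF z w] by simp
    finally have eq: "2 - 2 * overlap z w = (cmod (w - z))\<^sup>2 * (2 * gram_quotient z w / (1 + overlap z w))" .
    have "sqrt (2 - 2 * overlap z w) = \<delta> (z, w)"
      unfolding eq real_sqrt_mult[of "(cmod (w - z))\<^sup>2"] by (simp add: \<delta>_def \<Theta>_def)
    then have "D \<le> \<delta> (z, w) * (2 * M + D)"
      using berezin_diff_le[OF f z w] by (simp add: D_def M_def)
    then have "D * (1 - \<delta> (z, w)) \<le> 2 * M * \<delta> (z, w)" by (simp add: algebra_simps)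
    then have "D \<le> 2 * M * \<delta> (z, w) / (1 - \<delta> (z, w))" using x(2) by (simp add: pos_le_divide_eq)
    also have "\<dots> = 2 * M * cmod (w - z) * (\<Theta> (z, w) / (1 - \<delta> (z, w)))"
      by (simp add: \<delta>_def)
    also have "\<dots> \<le> 2 * M * cmod (w - z) * (rho \<alpha> \<beta> p + \<epsilon>)"
      using M x(1) by (intro mult_left_mono) auto
    finally show "cmod z < 1 \<and> cmod w < 1 \<and>
     cmod (berezin \<alpha> \<beta> f z - berezin \<alpha> \<beta> f w) \<le> 2 * BMO_norm \<alpha> \<beta> f * (rho \<alpha> \<beta> p + \<epsilon>) * cmod (w - z)"
      using z w by (simp add: D_def M_def mult_ac)
  qed
qed

end

section \<open>Integration along curves\<close>

text \<open>Continuity gives measurability off \<open>S\<close>, the constant \<open>B\<close>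
  dominates, and the finite set \<open>S\<close> is negligible.\<close>

lemma integrable_bounded_continuous_off_finite:
  fixes f :: "real \<Rightarrow> 'a::euclidean_space"
  assumes S: "finite S" and f: "continuous_on ({a..b} - S) f"
    and B: "\<And>x. x \<in> {a..b} \<Longrightarrow> norm (f x) \<le> B"
  shows "f integrable_on {a..b}"
proof -
  have m: "{a..b} - S \<in> sets lebesgue" using S by (simp add: finite_imp_closed borel_closed)
  have negl: "negligible {x \<in> {a..b} - ({a..b} - S). g x \<noteq> 0}" "negligible {x \<in> ({a..b} - S) - {a..b}. g x \<noteq> 0}"
    for g :: "real \<Rightarrow> 'c::real_vector"
    by (rule negligible_subset[OF negligible_finite[OF S]]; blast)+
  have "(\<lambda>_. B) integrable_on {a..b}" by (rule integrable_const_ivl)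
  then have "(\<lambda>_. B) integrable_on ({a..b} - S)"
    by (rule integrable_spike_set[OF _ negl])
  then have "f integrable_on ({a..b} - S)"
    by (rule measurable_bounded_by_integrable_imp_integrable
        [OF continuous_imp_measurable_on_sets_lebesgue[OF f m] _ _ m]) (simp add: B)
  then show ?thesis by (rule integrable_spike_set[OF _ negl(2,1)])
qed

text \<open>One-sided limits bound \<open>g\<close> on both sides of each point; bisection makes
  this global.\<close>

lemma bounded_image_of_one_sided_limits:
  fixes g :: "real \<Rightarrow> 'a::real_normed_vector"
  assumes R: "\<And>t. t \<in> {0..<1} \<Longrightarrow> \<exists>l. (g \<longlongrightarrow> l) (at_right t)"
    and L: "\<And>t. t \<in> {0<..1} \<Longrightarrow> \<exists>l. (g \<longlongrightarrow> l) (at_left t)"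
  shows "bounded (g ` {0..1})"
proof -
  \<comment> \<open>The intersection is taken because bisection also tests intervals around an
    endpoint that leave \<open>{0..1}\<close>.\<close>
  define P where "P a b \<longleftrightarrow> bounded (g ` ({a..b} \<inter> {0..1}))" for a b
  have ev: "\<forall>\<^sub>F s in F. norm (g s) \<le> norm l + 1" if "(g \<longlongrightarrow> l) F" for l F
    using order_tendstoD(2)[OF tendsto_norm[OF that], of "norm l + 1"] by (auto elim: eventually_mono)
  have "P 0 1" using zero_le_one
  proof (induction rule: Bolzano)
    case (trans a b c)
    then have "{a..c} \<inter> {0..1} = ({a..b} \<inter> {0..1}) \<union> ({b..c} \<inter> {0..1})" by auto
    then show ?case using trans unfolding P_def by (metis bounded_Un image_Un)
  next
    case (local x)
    \<comment> \<open>At the right endpoint there is no admissible \<open>y\<close>, so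
      \<open>b\<close> and \<open>C\<close> are arbitrary there; likewise on the left below.\<close>
    obtain b C where b: "b > x" "\<And>y. y > x \<Longrightarrow> y < b \<Longrightarrow> y \<le> 1 \<Longrightarrow> norm (g y) \<le> C"
    proof (cases "x < 1")
      case True
      then obtain l where "(g \<longlongrightarrow> l) (at_right x)" using R[of x] local by auto
      then obtain b where "b > x" "\<forall>y>x. y < b \<longrightarrow> norm (g y) \<le> norm l + 1"
        using ev[of l "at_right x"] unfolding eventually_at_right_field by auto
      then show ?thesis using that[of b "norm l + 1"] by simp
    qed (use that[of "x + 1" 0] in auto)
    obtain a D where a: "a < x" "\<And>y. y < x \<Longrightarrow> a < y \<Longrightarrow> y \<ge> 0 \<Longrightarrow> norm (g y) \<le> D"
    proof (cases "x > 0")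
      case True
      then obtain l where "(g \<longlongrightarrow> l) (at_left x)" using L[of x] local by auto
      then obtain a where "a < x" "\<forall>y>a. y < x \<longrightarrow> norm (g y) \<le> norm l + 1"
        using ev[of l "at_left x"] unfolding eventually_at_left_field by auto
      then show ?thesis using that[of a "norm l + 1"] by simp
    qed (use that[of "x - 1" 0] in auto)
    show ?case
    proof (intro exI[of _ "min (b - x) (x - a)"] conjI allI impI)
      show "0 < min (b - x) (x - a)" using a b by simp
      fix u v assume uv: "u \<le> x \<and> x \<le> v \<and> v - u < min (b - x) (x - a)"
      \<comment> \<open>The value at \<open>x\<close> enters separately, since one-sided limits
        ignore it.\<close>
      have "norm (g y) \<le> max (norm (g x)) (max C D)" if "y \<in> {u..v} \<inter> {0..1}" for y
      proof (cases y x rule: linorder_cases)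
        case less
        then have "norm (g y) \<le> D" using that uv by (intro a(2)) auto
        then show ?thesis by simp
      next
        case greater
        then have "norm (g y) \<le> C" using that uv by (intro b(2)) auto
        then show ?thesis by simp
      qed simp
      then show "P u v" unfolding P_def bounded_iff by blast
    qed
  qed
  then show ?thesis by (simp add: P_def)
qed

section \<open>Comparison with the length of a curve\<close>

context weighted_disc
begin

text \<open>The local Lipschitz bound holds on short pieces of the curve with a slack
  \<open>\<epsilon>\<close>. Bisection adds the pieces up, and then the slack tends to
  \<open>0\<close>.\<close>

lemma berezin_diff_le_curve_length:
  assumes f: "f \<in> BMO \<alpha> \<beta>" and \<gamma>: "piecewise_C1_curve \<gamma>" "path_image \<gamma> \<subseteq> ball 0 1"
  shows "cmod (berezin \<alpha> \<beta> f (pathfinish \<gamma>) - berezin \<alpha> \<beta> f (pathstart \<gamma>))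
    \<le> 2 * BMO_norm \<alpha> \<beta> f * curve_length \<alpha> \<beta> \<gamma>"
proof -
  define M where "M = BMO_norm \<alpha> \<beta> f"
  have M: "M \<ge> 0" using BMO_D(3)[OF f] by (simp add: M_def)
  define \<gamma>' where "\<gamma>' s = vector_derivative \<gamma> (at s)" for s
  define H where "H s = berezin \<alpha> \<beta> f (\<gamma> s)" for s
  have "valid_path \<gamma>" using \<gamma>(1) by (simp add: piecewise_C1_curve_def)
  then obtain S where S: "finite S" and cont\<gamma>: "continuous_on {0..1} \<gamma>"
    and der: "\<And>s. s \<in> {0..1} - S \<Longrightarrow> (\<gamma> has_vector_derivative \<gamma>' s) (at s)"
    and cont\<gamma>': "continuous_on ({0..1} - S) \<gamma>'"
    by (auto simp: valid_path_def piecewise_C1_differentiable_on_def C1_differentiable_on_eq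
        \<gamma>'_def[abs_def] vector_derivative_works)
  have disc: "cmod (\<gamma> s) < 1" if "s \<in> {0..1}" for s
    using \<gamma>(2) that unfolding path_image_def by (auto simp: image_subset_iff)
  \<comment> \<open>The one-sided limits required of the derivative enter here; they make the speed,
    and with it the length integrand, bounded and integrable.\<close>
  have "bounded (\<gamma>' ` {0..1})"
    using \<gamma>(1) unfolding piecewise_C1_curve_def \<gamma>'_def[abs_def]
    by (intro bounded_image_of_one_sided_limits) auto
  then obtain B where B: "\<And>s. s \<in> {0..1} \<Longrightarrow> cmod (\<gamma>' s) \<le> B"
    unfolding bounded_iff by (metis imageI)
  have contr: "continuous_on {0..1} (\<lambda>s. rho \<alpha> \<beta> (\<gamma> s))"
    by (rule continuous_on_compose2[OF continuous_on_rho cont\<gamma>]) (use disc in auto)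
  then have "bounded ((\<lambda>s. rho \<alpha> \<beta> (\<gamma> s)) ` {0..1})"
    by (intro compact_imp_bounded compact_continuous_image) auto
  then obtain R where R: "\<And>s. s \<in> {0..1} \<Longrightarrow> \<bar>rho \<alpha> \<beta> (\<gamma> s)\<bar> \<le> R"
    unfolding bounded_iff real_norm_def by (metis (no_types, lifting) imageI)
  have rho: "0 \<le> rho \<alpha> \<beta> (\<gamma> s)" if "s \<in> {0..1}" for s using rho_nonneg disc that by simp
  have int1: "(\<lambda>s. cmod (\<gamma>' s)) integrable_on {0..1}"
    by (rule integrable_bounded_continuous_off_finite[OF S, of _ _ _ B])
       (use B in \<open>auto intro!: continuous_intros cont\<gamma>'\<close>)
  have int2: "(\<lambda>s. rho \<alpha> \<beta> (\<gamma> s) * cmod (\<gamma>' s)) integrable_on {0..1}"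
  proof (rule integrable_bounded_continuous_off_finite[OF S, of _ _ _ "R * B"])
    show "continuous_on ({0..1} - S) (\<lambda>s. rho \<alpha> \<beta> (\<gamma> s) * cmod (\<gamma>' s))"
      by (intro continuous_intros cont\<gamma>' continuous_on_subset[OF contr]) auto
    show "norm (rho \<alpha> \<beta> (\<gamma> s) * cmod (\<gamma>' s)) \<le> R * B" if "s \<in> {0..1}" for s
      using R[OF that] B[OF that] by (auto simp: abs_mult intro!: mult_mono)
  qed
  have incr: "cmod (\<gamma> b - \<gamma> a) \<le> integral {a..b} (\<lambda>s. cmod (\<gamma>' s))" if "0 \<le> a" "a \<le> b" "b \<le> 1" for a b
  proof -
    have "(\<gamma>' has_integral (\<gamma> b - \<gamma> a)) {a..b}"
      using that der S by (intro fundamental_theorem_of_calculus_interior_strong[of S])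
        (auto intro: continuous_on_subset[OF cont\<gamma>])
    moreover have "(\<lambda>s. cmod (\<gamma>' s)) integrable_on {a..b}"
      using that by (intro integrable_on_subinterval[OF int1]) auto
    ultimately show ?thesis
      using integral_norm_bound_integral[of \<gamma>' "{a..b}" "\<lambda>s. cmod (\<gamma>' s)"]
      by (auto simp: has_integral_iff)
  qed
  have main: "cmod (H 1 - H 0) \<le> integral {0..1} (\<lambda>s. 2 * M * ((rho \<alpha> \<beta> (\<gamma> s) + \<epsilon>) * cmod (\<gamma>' s)))"
    if \<epsilon>: "\<epsilon> > 0" for \<epsilon>
  proof -
    define N where "N s = 2 * M * ((rho \<alpha> \<beta> (\<gamma> s) + \<epsilon>) * cmod (\<gamma>' s))" for s
    have intN: "N integrable_on {0..1}"
      unfolding N_def distrib_right by (intro integrable_on_mult_right integrable_add int1 int2)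
    \<comment> \<open>The premises make the claim vacuous for intervals that bisection tests outside
      \<open>{0..1}\<close>.\<close>
    define P where "P a b \<longleftrightarrow> (0 \<le> a \<longrightarrow> a \<le> b \<longrightarrow> b \<le> 1 \<longrightarrow> cmod (H b - H a) \<le> integral {a..b} N)" for a b
    have "P 0 1" using zero_le_one
    proof (induction rule: Bolzano)
      case (trans a b c)
      show ?case unfolding P_def
      proof (intro impI)
        assume a: "0 \<le> a" "a \<le> c" "c \<le> 1"
        have "cmod (H c - H a) \<le> cmod (H b - H a) + cmod (H c - H b)"
          using norm_triangle_ineq[of "H b - H a" "H c - H b"] by simp
        also have "\<dots> \<le> integral {a..b} N + integral {b..c} N"
          using trans a unfolding P_def by (intro add_mono) auto
        also have "\<dots> = integral {a..c} N"
          using trans a by (intro Henstock_Kurzweil_Integration.integral_combine integrable_on_subinterval[OF intN]) auto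
        finally show "cmod (H c - H a) \<le> integral {a..c} N" .
      qed
    next
      case (local x)
      then have x: "x \<in> {0..1}" by simp
      obtain d where d: "d > 0" "\<And>z w. dist z (\<gamma> x) < d \<Longrightarrow> dist w (\<gamma> x) < d \<Longrightarrow> cmod z < 1 \<and> cmod w < 1 \<and>
          cmod (berezin \<alpha> \<beta> f z - berezin \<alpha> \<beta> f w) \<le> 2 * M * (rho \<alpha> \<beta> (\<gamma> x) + \<epsilon> / 2) * cmod (w - z)"
        using berezin_locally_Lipschitz[OF f disc[OF x], of "\<epsilon> / 2"] \<epsilon> unfolding M_def by auto
      obtain d1 where d1: "d1 > 0" "\<And>s. s \<in> {0..1} \<Longrightarrow> dist s x < d1 \<Longrightarrow> dist (\<gamma> s) (\<gamma> x) < d"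
        using cont\<gamma> x d(1) unfolding continuous_on_iff by blast
      \<comment> \<open>Half of the slack went into the Lipschitz constant at \<open>x\<close>; the
        other half pays for the variation of \<open>rho\<close> along the curve near
        \<open>x\<close>.\<close>
      obtain d2 where d2: "d2 > 0" "\<And>s. s \<in> {0..1} \<Longrightarrow> dist s x < d2 \<Longrightarrow>
          dist (rho \<alpha> \<beta> (\<gamma> s)) (rho \<alpha> \<beta> (\<gamma> x)) < \<epsilon> / 2"
        using contr x half_gt_zero[OF \<epsilon>] unfolding continuous_on_iff by blast
      show ?case
      proof (intro exI[of _ "min d1 d2"] conjI allI impI)
        show "0 < min d1 d2" using d1 d2 by simp
        fix a b assume ab: "a \<le> x \<and> x \<le> b \<and> b - a < min d1 d2"
        show "P a b" unfolding P_def
        proof (intro impI)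
          assume a: "0 \<le> a" "a \<le> b" "b \<le> 1"
          have sub: "g integrable_on {a..b}" if "g integrable_on {0..1}" for g :: "real \<Rightarrow> real"
            using a by (intro integrable_on_subinterval[OF that]) auto
          let ?c = "2 * M * (rho \<alpha> \<beta> (\<gamma> x) + \<epsilon> / 2)"
          have c: "?c \<ge> 0" using M rho[OF x] \<epsilon> by simp
          have "cmod (H b - H a) \<le> ?c * cmod (\<gamma> a - \<gamma> b)"
            unfolding H_def using ab a by (intro conjunct2[OF conjunct2[OF d(2)]] d1) (auto simp: dist_real_def)
          also have "\<dots> \<le> ?c * integral {a..b} (\<lambda>s. cmod (\<gamma>' s))"
            using incr[of a b] a c by (intro mult_left_mono) (auto simp: norm_minus_commute)
          also have "\<dots> = integral {a..b} (\<lambda>s. ?c * cmod (\<gamma>' s))" by simp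
          also have "\<dots> \<le> integral {a..b} N"
          proof (rule integral_le)
            show "(\<lambda>s. ?c * cmod (\<gamma>' s)) integrable_on {a..b}"
              by (intro integrable_on_mult_right sub int1)
            show "N integrable_on {a..b}" by (rule sub[OF intN])
            fix s assume s: "s \<in> {a..b}"
            then have "dist (rho \<alpha> \<beta> (\<gamma> s)) (rho \<alpha> \<beta> (\<gamma> x)) < \<epsilon> / 2"
              using ab a by (intro d2) (auto simp: dist_real_def)
            then have "rho \<alpha> \<beta> (\<gamma> x) + \<epsilon> / 2 \<le> rho \<alpha> \<beta> (\<gamma> s) + \<epsilon>"
              unfolding dist_real_def by linarith
            then show "?c * cmod (\<gamma>' s) \<le> N s"
              unfolding N_def mult.assoc using M by (intro mult_left_mono mult_right_mono) auto
          qed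
          finally show "cmod (H b - H a) \<le> integral {a..b} N" .
        qed
      qed
    qed
    then show ?thesis by (simp add: P_def N_def[abs_def])
  qed
  define L where "L = integral {0..1} (\<lambda>s. cmod (\<gamma>' s))"
  have L: "L \<ge> 0" unfolding L_def by (intro integral_nonneg int1) auto
  have "cmod (H 1 - H 0) \<le> 2 * M * curve_length \<alpha> \<beta> \<gamma> + e" if e: "e > 0" for e :: real
  proof -
    \<comment> \<open>With this choice the error \<open>\<epsilon> * (2 * M * L)\<close> is at most
      \<open>e\<close>; the \<open>1\<close> keeps the denominator positive when \<open>M\<close> or
      \<open>L\<close> is \<open>0\<close>.\<close>
    define \<epsilon> where "\<epsilon> = e / (2 * M * L + 1)"
    have nonneg: "2 * M * L \<ge> 0" using M L by simp
    then have \<epsilon>: "\<epsilon> > 0" using e unfolding \<epsilon>_def by (intro divide_pos_pos) linarith+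
    have eq: "integral {0..1} (\<lambda>s. 2 * M * ((rho \<alpha> \<beta> (\<gamma> s) + \<epsilon>) * cmod (\<gamma>' s)))
      = 2 * M * (curve_length \<alpha> \<beta> \<gamma> + \<epsilon> * L)"
    proof -
      have "integral {0..1} (\<lambda>s. (rho \<alpha> \<beta> (\<gamma> s) + \<epsilon>) * cmod (\<gamma>' s))
        = integral {0..1} (\<lambda>s. rho \<alpha> \<beta> (\<gamma> s) * cmod (\<gamma>' s)) + integral {0..1} (\<lambda>s. \<epsilon> * cmod (\<gamma>' s))"
        unfolding distrib_right
        by (intro Henstock_Kurzweil_Integration.integral_add integrable_on_mult_right int1 int2)
      also have "\<dots> = curve_length \<alpha> \<beta> \<gamma> + \<epsilon> * L"
        by (simp add: curve_length_def L_def \<gamma>'_def)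
      finally show ?thesis by simp
    qed
    have "cmod (H 1 - H 0) \<le> 2 * M * curve_length \<alpha> \<beta> \<gamma> + \<epsilon> * (2 * M * L)"
      using main[OF \<epsilon>] unfolding eq distrib_left by (simp only: mult_ac)
    also have "\<epsilon> * (2 * M * L) \<le> \<epsilon> * (2 * M * L + 1)"
      using \<epsilon> by (intro mult_left_mono) auto
    also have "\<dots> = e"
    proof -
      have "2 * M * L + 1 \<noteq> 0" using nonneg by linarith
      then show ?thesis unfolding \<epsilon>_def by (rule nonzero_eq_divide_eq[THEN iffD1]) (rule refl)
    qed
    finally show ?thesis by (simp only: add_left_mono)
  qed
  then have "cmod (H 1 - H 0) \<le> 2 * M * curve_length \<alpha> \<beta> \<gamma>" by (rule field_le_epsilon)
  then show ?thesis unfolding H_def M_def pathstart_def pathfinish_def .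
qed

end

section \<open>Passing to the infimum over curves\<close>

lemma piecewise_C1_curve_linepath: "piecewise_C1_curve (linepath z w)"
  unfolding piecewise_C1_curve_def vector_derivative_linepath_at
  by (intro conjI ballI exI[of _ "w - z"] tendsto_const valid_path_linepath)

theorem theorem2:
  fixes \<alpha> \<beta> :: real and f :: "complex \<Rightarrow> complex"
  assumes "\<alpha> > -1" and "-1 < \<beta>" and "\<beta> \<le> 0"
    and "f \<in> BMO \<alpha> \<beta>"
  shows "\<forall>z\<in>ball 0 1. \<forall>w\<in>ball 0 1.
    cmod (berezin \<alpha> \<beta> f z - berezin \<alpha> \<beta> f w) \<le> 2 * BMO_norm \<alpha> \<beta> f * bp_dist \<alpha> \<beta> z w"
proof (intro ballI)
  fix z w :: complex
  assume zw: "z \<in> ball 0 1" "w \<in> ball 0 1"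
  interpret weighted_disc \<alpha> \<beta> using assms by unfold_locales
  let ?M = "BMO_norm \<alpha> \<beta> f" and ?D = "cmod (berezin \<alpha> \<beta> f z - berezin \<alpha> \<beta> f w)"
  let ?C = "{curve_length \<alpha> \<beta> \<gamma> | \<gamma>. piecewise_C1_curve \<gamma> \<and> path_image \<gamma> \<subseteq> ball 0 1 \<and>
      pathstart \<gamma> = z \<and> pathfinish \<gamma> = w}"
  have le: "?D \<le> 2 * ?M * l" if "l \<in> ?C" for l
    using that berezin_diff_le_curve_length[OF assms(4)] by (auto simp: norm_minus_commute)
  have "path_image (linepath z w) \<subseteq> ball 0 1"
    using zw by (simp add: closed_segment_subset)
  \<comment> \<open>The segment stays in the convex disc, so the infimum is over a nonempty
    set.\<close>
  then have ne: "curve_length \<alpha> \<beta> (linepath z w) \<in> ?C"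
    by (intro CollectI exI[of _ "linepath z w"]) (simp add: piecewise_C1_curve_linepath)
  show "?D \<le> 2 * ?M * bp_dist \<alpha> \<beta> z w"
  proof (cases "?M = 0")
    \<comment> \<open>Division by \<open>?M\<close> is impossible here, but the bound along the
      segment already gives \<open>?D \<le> 0\<close>.\<close>
    case True
    then show ?thesis using le[OF ne] by simp
  next
    case False
    then have M: "?M > 0" using BMO_D(3)[OF assms(4)] by simp
    have "?D / (2 * ?M) \<le> Inf ?C"
      using ne le M by (intro cInf_greatest) (auto simp: field_simps)
    then show ?thesis using M by (simp add: bp_dist_def field_simps)
  qed
qed

end
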